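(* Consider a sequence of screening problems indexed by the number of alternatives $k$, with $m>1$ and $\delta>0$ fixed. In the problem with $k$ alternatives, alternative $i$ produces i.i.d. $\mathrm{Normal}(\mu_i,\sigma_i^2)$ observations, independent across alternatives, with $\mu_1\ge\dots\ge\mu_k$; let $\mathcal{G}=\{i:\mu_i\ge\mu_m-\delta\}$. Assume there is $\bar\sigma>0$ with $\max_i\sigma_i^2\le\bar\sigma^2$ for every $k$, and $\bar g$ with $|\mathcal{G}|\le\bar g$ for every $k$. For any $\alpha\in(0,1)$, if the EFG-$m$ algorithm is run with total budget $B=(n_0+n_g)k$, where $$n_0=\frac{8\bar\sigma^2}{\delta^2}\log\frac{2m}{\alpha},\qquad n_g\ge\frac{\alpha}{2}+\frac{4\alpha\bar\sigma^2}{\delta^2},$$ then $\liminf_{k\to\infty}\mathrm{PGS}_m\ge1-\alpha$. Consequently EFG-$m$ is consistent, i.e., for every $\alpha\in(0,1)$ there exists $c>0$ such that $\liminf_{k\to\infty}\mathrm{PGS}_m\ge1-\alpha$ when $B=ck$.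
   Context: EFG-$m$ (explore-first top-$m$ greedy) algorithm, with inputs $m$, $k$, total budget $B$ and exploration size $n_0$ with $n_0k<B$: (exploration) take $n_0$ observations from each alternative and set $n_i=n_0$; (greedy) while $\sum_i n_i<B$, let $S$ be the indices of the $m$ largest current sample means, take one additional observation from each $j\in S$ and update its sample mean and count. The output $\mathcal{S}$ is the set of indices of the $m$ largest sample means when the budget is exhausted. $\mathrm{PGS}_m=\Pr\{\mathcal{S}\subseteq\mathcal{G}\}$. *)

theory Defs
  imports "HOL-Probability.Probability"
begin

text \<open>Alternatives are indexed 0,...,k-1 (paper: 1,...,k). Observation j (0-based)
  of alternative i is the coordinate X (i, j).\<close>

definition obs_space :: "(nat \<Rightarrow> real) \<Rightarrow> (nat \<Rightarrow> real) \<Rightarrow> nat \<Rightarrow> nat \<Rightarrow> (nat \<times> nat \<Rightarrow> real) measure" where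
  "obs_space \<mu> \<sigma> k N =
     PiM ({..<k} \<times> {..<N}) (\<lambda>(i, j). density lborel (normal_density (\<mu> i) (\<sigma> i)))"

definition sample_mean :: "(nat \<times> nat \<Rightarrow> real) \<Rightarrow> (nat \<Rightarrow> nat) \<Rightarrow> nat \<Rightarrow> real" where
  "sample_mean X n i = (\<Sum>j<n i. X (i, j)) / real (n i)"

definition top_set :: "nat \<Rightarrow> nat \<Rightarrow> (nat \<Rightarrow> real) \<Rightarrow> nat set" where
  "top_set m k f = {i. i < k \<and> card {j. j < k \<and> (f j > f i \<or> (f j = f i \<and> j < i))} < m}"

fun efg_counts :: "nat \<Rightarrow> nat \<Rightarrow> nat \<Rightarrow> (nat \<times> nat \<Rightarrow> real) \<Rightarrow> nat \<Rightarrow> (nat \<Rightarrow> nat)" where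
  "efg_counts m k n0 X 0 = (\<lambda>i. n0)"
| "efg_counts m k n0 X (Suc t) =
     (let n = efg_counts m k n0 X t; S = top_set m k (sample_mean X n)
      in (\<lambda>i. if i \<in> S then Suc (n i) else n i))"

text \<open>Number of greedy rounds: the while loop stops at the first round where the
  total number of observations is no longer below the budget B.\<close>
definition efg_rounds :: "nat \<Rightarrow> nat \<Rightarrow> nat \<Rightarrow> nat \<Rightarrow> (nat \<times> nat \<Rightarrow> real) \<Rightarrow> nat" where
  "efg_rounds m k n0 B X = (LEAST t. \<not> ((\<Sum>i<k. efg_counts m k n0 X t i) < B))"

definition efg_output :: "nat \<Rightarrow> nat \<Rightarrow> nat \<Rightarrow> nat \<Rightarrow> (nat \<times> nat \<Rightarrow> real) \<Rightarrow> nat set" where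
  "efg_output m k n0 B X =
     top_set m k (sample_mean X (efg_counts m k n0 X (efg_rounds m k n0 B X)))"

text \<open>Set of good alternatives G = {i : mu_i >= mu_m - delta} (mu_m is index m-1).\<close>
definition good_set :: "nat \<Rightarrow> real \<Rightarrow> nat \<Rightarrow> (nat \<Rightarrow> real) \<Rightarrow> nat set" where
  "good_set m \<delta> k \<mu> = {i. i < k \<and> \<mu> i \<ge> \<mu> (m - 1) - \<delta>}"

text \<open>PGS_m = Pr{output subset of G}. At most n0 + B observations per alternative are ever used.\<close>
definition PGS :: "nat \<Rightarrow> real \<Rightarrow> nat \<Rightarrow> nat \<Rightarrow> nat \<Rightarrow> (nat \<Rightarrow> real) \<Rightarrow> (nat \<Rightarrow> real) \<Rightarrow> real" where
  "PGS m \<delta> k n0 B \<mu> \<sigma> =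
     (let M = obs_space \<mu> \<sigma> k (n0 + B)
      in measure M {X \<in> space M. efg_output m k n0 B X \<subseteq> good_set m \<delta> k \<mu>})"

end

theory Submission
  imports Defs
begin

text \<open>
  Let \<open>b = \<mu>\<^sub>m - \<delta>/2\<close> and call a greedy round bad if it samples an alternative outside \<open>G\<close>.
  With probability at least \<open>1 - \<alpha>/2\<close> (maximal inequality for the exponential martingale) the
  sample means of the top \<open>m\<close> alternatives never fall below \<open>b\<close>, and then every bad round uses up
  one of the pairs \<open>(i, n)\<close> with \<open>i \<notin> G\<close> and \<open>n\<close>-th sample mean of \<open>i\<close> at least \<open>b\<close>. The number of
  such pairs is a sum of independent terms with mean at most \<open>q ^ n0 / (1 - q)\<close>, where
  \<open>q = exp (- \<delta>\<^sup>2 / (8 \<sigma>bar\<^sup>2))\<close>; since \<open>1 / (1 - q) < 1 + 8 \<sigma>bar\<^sup>2 / \<delta>\<^sup>2\<close> strictly, the law of large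
  numbers leaves a positive fraction of the rounds that are not bad.

  It remains to exclude that the last round is bad. Let \<open>w\<close> be the \<open>m\<close>-th largest among the minima
  over time of the sample means in \<open>G\<close>. Once an alternative of \<open>G\<close> with minimum at most \<open>w\<close> has
  been sampled at its minimum, the first good round is followed by good rounds only. As each good
  round samples some alternative of \<open>G\<close> with minimum at most \<open>w\<close>, a bad last round allows no more
  good rounds than the total of the argmin times over \<open>G\<close>. This total is bounded in probability
  because \<open>card G\<close> is bounded and the argmin time of the running means of a normal sequence does
  not depend on its mean and variance.
\<close>

section \<open>Dynamics of the greedy phase\<close>

lemma top_set_less: "i \<in> top_set m k f \<Longrightarrow> i < k"
  by (simp add: top_set_def)

lemma finite_top_set [simp]: "finite (top_set m k f)"
  by (rule finite_subset[of _ "{..<k}"]) (auto simp: top_set_def)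

text \<open>Comparison by value with ties broken by index is a strict total order. If
  \<open>j\<close> ranked above \<open>i\<close>, everything above \<open>j\<close> would be above
  \<open>i\<close>, and \<open>j\<close> would inherit membership from \<open>i\<close>.\<close>

lemma top_set_beats:
  assumes "i \<in> top_set m k f" "j \<notin> top_set m k f" "j < k"
  shows "f i > f j \<or> f i = f j \<and> i < j"
proof (rule ccontr)
  assume "\<not> ?thesis"
  with assms have "f j > f i \<or> f j = f i \<and> j < i"
    by (metis linorder_neqE_nat linorder_neqE_linordered_idom)
  then have "{l. l < k \<and> (f l > f j \<or> f l = f j \<and> l < j)} \<subseteq> {l. l < k \<and> (f l > f i \<or> f l = f i \<and> l < i)}"
    by auto
  then have "card {l. l < k \<and> (f l > f j \<or> f l = f j \<and> l < j)}
      \<le> card {l. l < k \<and> (f l > f i \<or> f l = f i \<and> l < i)}"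
    by (rule card_mono[rotated]) auto
  with assms show False
    by (auto simp: top_set_def)
qed

text \<open>The rank is strictly monotone along \<open>beats\<close>, hence a bijection of
  \<open>{..<k}\<close> onto itself, and the top set is the preimage of
  \<open>{..<m}\<close>.\<close>

lemma card_top_set:
  assumes "m \<le> k"
  shows "card (top_set m k f) = m"
proof -
  define beats where "beats j i \<longleftrightarrow> f j > f i \<or> f j = f i \<and> j < i" for i j
  define rank where "rank i = card {j. j < k \<and> beats j i}" for i
  have rank_less: "rank j < rank i" if "beats j i" "j < k" for i j
    unfolding rank_def
    by (rule psubset_card_mono) (use that in \<open>auto simp: beats_def\<close>)
  have total: "beats i j \<or> beats j i" if "i \<noteq> j" for i j
    using that by (auto simp: beats_def)
  have inj: "inj_on rank {..<k}"
    by (rule inj_onI) (metis lessThan_iff less_irrefl rank_less total)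
  have "rank ` {..<k} \<subseteq> {..<k}"
  proof safe
    fix i assume "i < k"
    then have "{j. j < k \<and> beats j i} \<subset> {..<k}"
      by (auto simp: beats_def)
    from psubset_card_mono[OF _ this] show "rank i < k"
      by (simp add: rank_def)
  qed
  then have surj: "rank ` {..<k} = {..<k}"
    using inj by (intro endo_inj_surj) auto
  have top: "top_set m k f = {i \<in> {..<k}. rank i < m}"
    by (auto simp: top_set_def rank_def beats_def)
  have "rank ` top_set m k f = {..<m}"
    unfolding top using surj assms by (auto simp: image_iff set_eq_iff) (metis lessThan_iff order_less_le_trans)
  moreover have "inj_on rank (top_set m k f)"
    by (rule inj_on_subset[OF inj]) (auto simp: top)
  ultimately show ?thesis
    by (metis card_image card_lessThan)
qed

text \<open>The \<open>m\<close>-th largest value, obtained as the largest attained \<open>w\<close>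
  with at least \<open>m\<close> values at or above it.\<close>

lemma order_statistic_exists:
  fixes I :: "nat \<Rightarrow> real"
  assumes "0 < m" "m \<le> g"
  obtains w where "card {i. i < g \<and> I i > w} < m" "m \<le> card {i. i < g \<and> I i \<ge> w}"
proof -
  define Ws where "Ws = {w \<in> I ` {..<g}. m \<le> card {i. i < g \<and> I i \<ge> w}}"
  have fin: "finite Ws"
    by (simp add: Ws_def)
  have "Min (I ` {..<g}) \<in> Ws"
  proof -
    have "{i. i < g \<and> I i \<ge> Min (I ` {..<g})} = {..<g}"
      by auto
    then show ?thesis
      using assms Min_in[of "I ` {..<g}"] by (force simp: Ws_def lessThan_empty_iff simp del: Min_in)
  qed
  then have w: "Max Ws \<in> Ws"
    using fin Max_in by blast
  \<comment> \<open>If \<open>m\<close> values lay strictly above, the least of them would be a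
    larger member of \<open>Ws\<close>.\<close>
  have "card {i. i < g \<and> I i > Max Ws} < m"
  proof (rule ccontr)
    let ?U = "{i. i < g \<and> I i > Max Ws}"
    assume "\<not> card ?U < m"
    then have ge: "m \<le> card ?U" by simp
    have ne: "?U \<noteq> {}"
      using ge assms(1) by (metis card.empty not_less)
    let ?v = "Min (I ` ?U)"
    have v: "?v \<in> I ` ?U"
      using ne by (intro Min_in) auto
    have "?U \<subseteq> {i. i < g \<and> I i \<ge> ?v}"
      by auto
    then have "card ?U \<le> card {i. i < g \<and> I i \<ge> ?v}"
      by (rule card_mono[rotated]) auto
    with ge v have "?v \<in> Ws"
      by (auto simp: Ws_def)
    then have "?v \<le> Max Ws"
      using fin by simp
    with v show False
      by auto
  qed
  with w that show thesis
    by (auto simp: Ws_def)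
qed

section \<open>Trajectories of the greedy phase\<close>

definition running_mean :: "(nat \<Rightarrow> real) \<Rightarrow> nat \<Rightarrow> real" where
  "running_mean x n = (\<Sum>j<n. x j) / real n"

definition efg_set :: "nat \<Rightarrow> nat \<Rightarrow> nat \<Rightarrow> (nat \<times> nat \<Rightarrow> real) \<Rightarrow> nat \<Rightarrow> nat set" where
  "efg_set m k n0 X t = top_set m k (sample_mean X (efg_counts m k n0 X t))"

lemma sample_mean_running_mean:
  "sample_mean X n i = running_mean (\<lambda>j. X (i, j)) (n i)"
  by (simp add: sample_mean_def running_mean_def)

lemma efg_counts_Suc:
  "efg_counts m k n0 X (Suc t) i =
    (if i \<in> efg_set m k n0 X t then Suc (efg_counts m k n0 X t i) else efg_counts m k n0 X t i)"
  by (simp add: Let_def efg_set_def)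

declare efg_counts.simps(2) [simp del]

lemma efg_counts_mono: "s \<le> t \<Longrightarrow> efg_counts m k n0 X s i \<le> efg_counts m k n0 X t i"
  by (induction t rule: dec_induct) (auto simp: efg_counts_Suc)

lemma efg_counts_ge: "n0 \<le> efg_counts m k n0 X t i"
  using efg_counts_mono[of 0 t] by simp

lemma efg_counts_le: "efg_counts m k n0 X t i \<le> n0 + t"
  by (induction t) (auto simp: efg_counts_Suc)

text \<open>The count of \<open>i\<close> grows strictly in each round that samples
  \<open>i\<close>, so alternative and count together identify the round. Both counting arguments
  rest on this injectivity.\<close>

lemma efg_counts_inj:
  assumes "i \<in> efg_set m k n0 X s" "i \<in> efg_set m k n0 X t"
    and "efg_counts m k n0 X s i = efg_counts m k n0 X t i"
  shows "s = t"
proof -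
  have less: "efg_counts m k n0 X s i < efg_counts m k n0 X t i"
    if "s < t" "i \<in> efg_set m k n0 X s" for s t
    using efg_counts_mono[of "Suc s" t m k n0 X i] that by (simp add: efg_counts_Suc)
  show ?thesis
    using less[of s t] less[of t s] assms by (cases s t rule: linorder_cases) auto
qed

text \<open>Counts move in steps of one, so no intermediate value is skipped.\<close>

lemma efg_counts_sampled_at:
  assumes "n0 \<le> n" "n < efg_counts m k n0 X t i"
  obtains s where "s < t" "i \<in> efg_set m k n0 X s" "efg_counts m k n0 X s i = n"
  using assms
proof (induction t arbitrary: thesis)
  case (Suc t)
  then show ?case
    by (metis efg_counts_Suc less_Suc_eq)
qed simp

lemma card_efg_set: "m \<le> k \<Longrightarrow> card (efg_set m k n0 X t) = m"
  by (simp add: efg_set_def card_top_set)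

lemma finite_efg_set [simp]: "finite (efg_set m k n0 X t)"
  by (simp add: efg_set_def)

lemma sum_efg_counts:
  assumes "m \<le> k"
  shows "(\<Sum>i<k. efg_counts m k n0 X t i) = n0 * k + m * t"
proof (induction t)
  case (Suc t)
  have sub: "efg_set m k n0 X t \<subseteq> {..<k}"
    by (auto simp: efg_set_def dest: top_set_less)
  have "(\<Sum>i<k. efg_counts m k n0 X (Suc t) i) =
      (\<Sum>i<k. efg_counts m k n0 X t i + (if i \<in> efg_set m k n0 X t then 1 else 0))"
    by (intro sum.cong) (auto simp: efg_counts_Suc)
  also have "\<dots> = (\<Sum>i<k. efg_counts m k n0 X t i) + card (efg_set m k n0 X t)"
    using sub by (simp add: sum.distrib sum.If_cases Int_absorb1)
  finally show ?case
    using Suc card_efg_set[OF assms] by simp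
qed simp

text \<open>Every round adds exactly \<open>m\<close> observations, so the number of rounds
  \<open>T\<close> does not depend on the data.\<close>

lemma efg_output_eq:
  assumes "0 < m" "m \<le> k"
  obtains T where "T \<le> B" "B \<le> n0 * k + m * T"
    "\<And>X. efg_output m k n0 B X = efg_set m k n0 X T"
proof
  let ?T = "LEAST t. \<not> n0 * k + m * t < B"
  have B: "\<not> n0 * k + m * B < B"
    using assms by (metis add.commute mult_le_mono1 not_less nat_mult_1 Suc_leI One_nat_def trans_le_add1)
  show "?T \<le> B"
    using B by (rule Least_le)
  show "B \<le> n0 * k + m * ?T"
    using LeastI[of "\<lambda>t. \<not> n0 * k + m * t < B", OF B] by simp
  show "efg_output m k n0 B X = efg_set m k n0 X ?T" for X
    by (simp add: efg_output_def efg_rounds_def efg_set_def sum_efg_counts[OF assms(2)])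
qed

section \<open>Counting bad and good rounds\<close>

text \<open>A bad round leaves out one of the first \<open>m\<close> alternatives, whose mean is at
  least \<open>b\<close>; the outsider sampled in its stead has a mean at least as large. Mapping
  the round to this outsider and its count is injective.\<close>

lemma card_bad_rounds_le:
  assumes m: "m \<le> g" "g \<le> k"
    and top: "\<And>i n. i < m \<Longrightarrow> n0 \<le> n \<Longrightarrow> n < n0 + T \<Longrightarrow> b \<le> running_mean (\<lambda>j. X (i, j)) n"
  shows "card {t. t < T \<and> \<not> efg_set m k n0 X t \<subseteq> {..<g}}
    \<le> (\<Sum>i\<in>{g..<k}. card {n. n0 \<le> n \<and> n < n0 + T \<and> b \<le> running_mean (\<lambda>j. X (i, j)) n})"
proof -
  let ?S = "efg_set m k n0 X" and ?c = "efg_counts m k n0 X"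
  let ?Bad = "{t. t < T \<and> \<not> ?S t \<subseteq> {..<g}}"
  let ?D = "SIGMA i:{g..<k}. {n. n0 \<le> n \<and> n < n0 + T \<and> b \<le> running_mean (\<lambda>j. X (i, j)) n}"
  define h where "h t = (SOME i. i \<in> ?S t \<and> g \<le> i)" for t
  have h: "h t \<in> ?S t \<and> g \<le> h t" if "t \<in> ?Bad" for t
    unfolding h_def by (rule someI_ex) (use that in \<open>auto simp: not_less\<close>)
  have count: "?c t i < n0 + T" if "t < T" for t i
    using efg_counts_le[of m k n0 X t i] that by simp
  have "inj_on (\<lambda>t. (h t, ?c t (h t))) ?Bad"
    by (rule inj_onI) (metis Pair_inject efg_counts_inj h)
  moreover have "(\<lambda>t. (h t, ?c t (h t))) ` ?Bad \<subseteq> ?D"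
  proof (rule image_subsetI)
    fix t assume "t \<in> ?Bad"
    then have t: "t < T" and bad: "\<not> ?S t \<subseteq> {..<g}" by auto
    let ?f = "sample_mean X (?c t)"
    have ht: "h t \<in> ?S t" "g \<le> h t"
      using h t bad by auto
    \<comment> \<open>The sampled set has \<open>m\<close> elements, one of which is
      \<open>h t\<close>, and \<open>h t\<close> is at least \<open>m\<close>.\<close>
    have "\<exists>j<m. j \<notin> ?S t"
    proof (rule ccontr)
      assume "\<not> ?thesis"
      then have "{..<m} \<subseteq> ?S t" "h t \<notin> {..<m}"
        using ht m by auto
      then have "{..<m} \<subset> ?S t"
        using ht by blast
      from psubset_card_mono[OF _ this] show False
        using m by (simp add: card_efg_set)
    qed
    then obtain j where j: "j < m" "j \<notin> ?S t" by blast
    then have "?f j \<le> ?f (h t)"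
      using top_set_beats[of "h t" m k ?f j] ht m by (auto simp: efg_set_def)
    moreover have "b \<le> ?f j"
      unfolding sample_mean_running_mean
      by (rule top) (use j count[OF t] efg_counts_ge in auto)
    ultimately have "b \<le> running_mean (\<lambda>j. X (h t, j)) (?c t (h t))"
      by (simp add: sample_mean_running_mean)
    moreover have "h t < k"
      using ht by (auto simp: efg_set_def dest: top_set_less)
    ultimately show "(h t, ?c t (h t)) \<in> ?D"
      using count[OF t] efg_counts_ge ht by auto
  qed
  ultimately have "card ?Bad \<le> card ?D"
    by (intro card_inj_on_le) (auto intro!: finite_SigmaI)
  then show ?thesis
    by simp
qed

text \<open>In each good round some sampled alternative of \<open>G\<close> with minimum at most
  \<open>w\<close> has not yet passed its argmin time; otherwise good rounds would persist up to
  \<open>T\<close>, against \<open>final\<close>. The pairs of alternative and count therefore lie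
  below the argmin times.\<close>

lemma card_good_rounds_le:
  assumes m: "0 < m" "m \<le> g" "g \<le> k"
    and argmin: "\<And>i. i < g \<Longrightarrow> n0 \<le> p i"
      "\<And>i n. i < g \<Longrightarrow> n0 \<le> n \<Longrightarrow> n \<le> n0 + T \<Longrightarrow>
         running_mean (\<lambda>j. X (i, j)) (p i) \<le> running_mean (\<lambda>j. X (i, j)) n"
    and final: "\<not> efg_set m k n0 X T \<subseteq> {..<g}"
  shows "card {t. t < T \<and> efg_set m k n0 X t \<subseteq> {..<g}} \<le> (\<Sum>i<g. p i - n0)"
proof -
  let ?S = "efg_set m k n0 X" and ?c = "efg_counts m k n0 X"
  define f where "f t i = sample_mean X (?c t) i" for t i
  define I where "I i = running_mean (\<lambda>j. X (i, j)) (p i)" for i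
  obtain w where w: "card {i. i < g \<and> I i > w} < m" "m \<le> card {i. i < g \<and> I i \<ge> w}"
    using order_statistic_exists[OF m(1,2)] by blast
  have S: "?S t = top_set m k (f t)" for t
    by (simp add: efg_set_def f_def[abs_def])
  have beats: "f t i > f t j \<or> f t i = f t j \<and> i < j" if "i \<in> ?S t" "j \<notin> ?S t" "j < k" for t i j
    using top_set_beats[of i m k "f t" j] that by (simp add: S)
  have cardS: "card (?S t) = m" for t
    using m by (intro card_efg_set) simp
  have Sk: "i < k" if "i \<in> ?S t" for i t
    using that by (auto simp: S dest: top_set_less)
  have f_Suc: "f (Suc t) i = f t i" if "i \<notin> ?S t" for t i
    using that by (simp add: f_def sample_mean_running_mean efg_counts_Suc)
  have f_ge: "I i \<le> f t i" if "i < g" "t \<le> T" for t i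
    unfolding I_def f_def sample_mean_running_mean
    using efg_counts_le[of m k n0 X t i] that efg_counts_ge by (intro argmin) auto
  have m_above: "m \<le> card {i. i < g \<and> f t i \<ge> w}" if "t \<le> T" for t
  proof -
    have "card {i. i < g \<and> I i \<ge> w} \<le> card {i. i < g \<and> f t i \<ge> w}"
      using f_ge[OF _ that] by (intro card_mono) force+
    with w show ?thesis by simp
  qed
  txt \<open>The invariant: either all alternatives outside \<open>G\<close> are at most \<open>w\<close>, which persists, or fewer
    than \<open>m\<close> alternatives of \<open>G\<close> exceed \<open>w\<close>, which bad rounds preserve.\<close>
  define low where "low t \<longleftrightarrow> (\<forall>i. g \<le> i \<and> i < k \<longrightarrow> f t i \<le> w)" for t
  have low_good: "?S t \<subseteq> {..<g}" if "low t" "t \<le> T" for t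
  proof
    fix i assume i: "i \<in> ?S t"
    show "i \<in> {..<g}"
    proof (rule ccontr)
      assume "i \<notin> {..<g}"
      then have ig: "g \<le> i" by simp
      let ?H = "{j. j < g \<and> f t j \<ge> w}"
      have "\<not> ?H \<subseteq> ?S t"
      proof
        assume "?H \<subseteq> ?S t"
        moreover have "i \<notin> ?H"
          using ig by simp
        ultimately have "?H \<subset> ?S t"
          using i by blast
        from psubset_card_mono[OF _ this] show False
          using m_above[OF that(2)] cardS by simp
      qed
      \<comment> \<open>Ties go to the smaller index and \<open>j < g \<le> i\<close>, so
        \<open>f t i \<le> w \<le> f t j\<close> contradicts the selection of \<open>i\<close> over
        \<open>j\<close>.\<close>
      then obtain j where j: "j < g" "f t j \<ge> w" "j \<notin> ?S t" by blast
      with beats[OF i j(3)] ig m that(1) Sk[OF i] show False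
        by (force simp: low_def)
    qed
  qed
  have low_Suc: "low (Suc t)" if "low t" "t \<le> T" for t
    unfolding low_def
  proof (intro allI impI)
    fix i assume i: "g \<le> i \<and> i < k"
    then have "i \<notin> ?S t"
      using low_good[OF that] by auto
    then show "f (Suc t) i \<le> w"
      using f_Suc that i by (auto simp: low_def)
  qed
  have low_le: "low t" if "low s" "s \<le> t" "t \<le> T" for s t
    using that(2,3)
  proof (induction t rule: dec_induct)
    case (step n)
    then show ?case by (simp add: low_Suc)
  qed (rule that)
  define reached where "reached t \<longleftrightarrow> low t \<or> card {i. i < g \<and> f t i > w} < m" for t
  have reached_Suc: "reached (Suc t)" if r: "reached t" and "t \<le> T" for t
  proof (cases "low t")
    case True
    then show ?thesis
      using low_Suc that by (simp add: reached_def)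
  next
    case False
    then obtain j where j: "g \<le> j" "j < k" "f t j > w"
      by (auto simp: low_def not_le)
    let ?P = "\<lambda>t. {i. i < g \<and> f t i > w}"
    have P: "card (?P t) < m"
      using r False by (simp add: reached_def)
    have sub: "?P (Suc t) \<subseteq> (?S t \<inter> {..<g}) \<union> ?P t"
      using f_Suc by force
    \<comment> \<open>If all sampled means exceed \<open>w\<close>, nothing new can rise above
      \<open>w\<close>. Otherwise everything above \<open>w\<close> is sampled, including
      \<open>j\<close> outside \<open>G\<close>, and fewer than \<open>m\<close> places remain for
      \<open>G\<close>.\<close>
    have "card ((?S t \<inter> {..<g}) \<union> ?P t) < m"
    proof (cases "?S t \<subseteq> {i. f t i > w}")
      case True
      then have "(?S t \<inter> {..<g}) \<union> ?P t = ?P t" by auto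
      with P show ?thesis by simp
    next
      case False
      then obtain i where i: "i \<in> ?S t" "f t i \<le> w" by force
      have up: "l \<in> ?S t" if "l < k" "f t l > w" for l
        using beats[OF i(1) _ that(1)] that i by force
      have "j \<in> ?S t" "j \<notin> (?S t \<inter> {..<g}) \<union> ?P t"
        using up j by auto
      moreover have "(?S t \<inter> {..<g}) \<union> ?P t \<subseteq> ?S t"
        using up m by auto
      ultimately have "(?S t \<inter> {..<g}) \<union> ?P t \<subset> ?S t"
        by blast
      from psubset_card_mono[OF _ this] show ?thesis
        by (simp add: cardS)
    qed
    moreover have "card (?P (Suc t)) \<le> card ((?S t \<inter> {..<g}) \<union> ?P t)"
      by (rule card_mono[OF _ sub]) simp
    ultimately show ?thesis
      by (simp add: reached_def)
  qed
  have reached_le: "reached t" if "reached s" "s \<le> t" "t \<le> T" for s t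
    using that(2,3)
  proof (induction t rule: dec_induct)
    case (step n)
    then show ?case by (simp add: reached_Suc)
  qed (rule that)
  \<comment> \<open>Unless \<open>low t\<close> holds already, fewer than \<open>m\<close> members
    of \<open>G\<close> lie above \<open>w\<close>, so a good round samples some \<open>i\<close>
    with \<open>f t i \<le> w\<close>; the unsampled alternatives outside \<open>G\<close> cannot
    exceed it.\<close>
  have reached_good: "low t" if r: "reached t" and sub: "?S t \<subseteq> {..<g}" for t
  proof (rule ccontr)
    assume nl: "\<not> low t"
    then have P: "card {i. i < g \<and> f t i > w} < m"
      using r by (simp add: reached_def)
    have "\<not> ?S t \<subseteq> {i. i < g \<and> f t i > w}"
      using card_mono[of "{i. i < g \<and> f t i > w}" "?S t"] P cardS[of t] by auto
    then obtain i where i': "i \<in> ?S t" "\<not> (i < g \<and> f t i > w)" by blast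
    with sub have i: "i \<in> ?S t" "f t i \<le> w" by auto
    obtain j where j: "g \<le> j" "j < k" "f t j > w"
      using nl by (auto simp: low_def not_le)
    then have "j \<notin> ?S t" using sub by auto
    from beats[OF i(1) this j(2)] i j show False by simp
  qed
  \<comment> \<open>Sampling a mean of at most \<open>w\<close> forces every alternative above
    \<open>w\<close> to be sampled too. If one of these is outside \<open>G\<close>, fewer than
    \<open>m\<close> are inside.\<close>
  have reachedI: "reached s" if i: "i \<in> ?S s" "f s i \<le> w" for s i
  proof (cases "low s")
    case False
    then obtain j where j: "g \<le> j" "j < k" "f s j > w"
      by (auto simp: low_def not_le)
    have up: "l \<in> ?S s" if "l < k" "f s l > w" for l
      using beats[OF i(1) _ that(1)] that i by force
    have "j \<in> ?S s" "j \<notin> {i. i < g \<and> f s i > w}"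
      using up j by auto
    moreover have "{i. i < g \<and> f s i > w} \<subseteq> ?S s"
      using up m by auto
    ultimately have "{i. i < g \<and> f s i > w} \<subset> ?S s"
      by blast
    from psubset_card_mono[OF _ this] show ?thesis
      by (simp add: cardS reached_def)
  qed (simp add: reached_def)
  let ?Good = "{t. t < T \<and> ?S t \<subseteq> {..<g}}"
  let ?D = "SIGMA i:{..<g}. {n0..<p i}"
  have ex: "\<exists>i. i \<in> ?S t \<and> i < g \<and> ?c t i < p i" if t: "t \<in> ?Good" for t
  proof -
    have "\<not> ?S t \<subseteq> {i. i < g \<and> I i > w}"
      using card_mono[of "{i. i < g \<and> I i > w}" "?S t"] w cardS[of t] by auto
    then obtain i where i': "i \<in> ?S t" "\<not> (i < g \<and> I i > w)" by blast
    with t have i: "i \<in> ?S t" "i < g" "I i \<le> w" by auto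
    have "?c t i < p i"
    proof (rule ccontr)
      assume "\<not> ?thesis"
      \<comment> \<open>The count after round \<open>t\<close> covers the case that \<open>i\<close>
        sits at its argmin time in round \<open>t\<close> itself.\<close>
      then have "p i < ?c (Suc t) i"
        using i by (simp add: efg_counts_Suc)
      then obtain s where s: "s < Suc t" "i \<in> ?S s" "?c s i = p i"
        using efg_counts_sampled_at[OF argmin(1)[OF i(2)]] by metis
      have "f s i = I i"
        by (simp add: f_def I_def sample_mean_running_mean s)
      then have "reached s"
        using i s reachedI by simp
      then have "reached t"
        using s t by (intro reached_le[of s t]) auto
      then have "low t"
        using t reached_good by simp
      then have "low T"
        using t by (intro low_le[of t T]) auto
      with low_good[of T] final show False by simp
    qed
    with i show ?thesis by blast
  qed
  define h where "h t = (SOME i. i \<in> ?S t \<and> i < g \<and> ?c t i < p i)" for t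
  have h: "h t \<in> ?S t \<and> h t < g \<and> ?c t (h t) < p (h t)" if "t \<in> ?Good" for t
    unfolding h_def by (rule someI_ex[OF ex[OF that]])
  have "inj_on (\<lambda>t. (h t, ?c t (h t))) ?Good"
    by (rule inj_onI) (metis Pair_inject efg_counts_inj h)
  moreover have "(\<lambda>t. (h t, ?c t (h t))) ` ?Good \<subseteq> ?D"
    using h efg_counts_ge by force
  ultimately have "card ?Good \<le> card ?D"
    by (intro card_inj_on_le) auto
  then show ?thesis
    by simp
qed

text \<open>Deterministic core: if round \<open>T\<close> were bad, the two counts would bound the
  number of all rounds before \<open>T\<close> by something smaller than \<open>T\<close>.\<close>

lemma efg_set_subset_good:
  assumes m: "0 < m" "m \<le> g" "g \<le> k"
    and top: "\<And>i n. i < m \<Longrightarrow> n0 \<le> n \<Longrightarrow> n \<le> n0 + T \<Longrightarrow> b \<le> running_mean (\<lambda>j. X (i, j)) n"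
    and argmin: "\<And>i n. i < g \<Longrightarrow> n0 \<le> n \<Longrightarrow> n \<le> n0 + T \<Longrightarrow>
        \<exists>p\<in>{n0..L}. running_mean (\<lambda>j. X (i, j)) p \<le> running_mean (\<lambda>j. X (i, j)) n"
    and few: "g * L + (\<Sum>i\<in>{g..<k}. card {n. n0 \<le> n \<and> n < n0 + T \<and> b \<le> running_mean (\<lambda>j. X (i, j)) n}) < T"
  shows "efg_set m k n0 X T \<subseteq> {..<g}"
proof (rule ccontr)
  assume final: "\<not> ?thesis"
  let ?r = "\<lambda>i. running_mean (\<lambda>j. X (i, j))"
  let ?G = "{t. t < T \<and> efg_set m k n0 X t \<subseteq> {..<g}}"
  let ?B = "{t. t < T \<and> \<not> efg_set m k n0 X t \<subseteq> {..<g}}"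
  \<comment> \<open>The witness in \<open>argmin\<close> may vary with \<open>n\<close>; a minimizer
    over the finite window serves all \<open>n\<close> at once.\<close>
  have "\<exists>p\<in>{n0..L}. \<forall>n. n0 \<le> n \<and> n \<le> n0 + T \<longrightarrow> ?r i p \<le> ?r i n" if i: "i < g" for i
  proof -
    obtain p0 where p0: "p0 \<in> {n0..L}"
      using argmin[OF i, of n0] by auto
    obtain p where p: "is_arg_min (?r i) (\<lambda>p. p \<in> {n0..L}) p"
      using ex_is_arg_min_if_finite[of "{n0..L}" "?r i"] p0 by auto
    show ?thesis
    proof (intro bexI[of _ p] allI impI)
      fix n assume "n0 \<le> n \<and> n \<le> n0 + T"
      then obtain q where "q \<in> {n0..L}" "?r i q \<le> ?r i n"
        using argmin[OF i] by blast
      with p show "?r i p \<le> ?r i n"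
        by (force simp: is_arg_min_linorder)
    qed (use p in \<open>simp add: is_arg_min_linorder\<close>)
  qed
  then obtain p where p: "\<And>i. i < g \<Longrightarrow> p i \<in> {n0..L}"
    "\<And>i n. i < g \<Longrightarrow> n0 \<le> n \<Longrightarrow> n \<le> n0 + T \<Longrightarrow> ?r i (p i) \<le> ?r i n"
    by metis
  have "card ?G \<le> (\<Sum>i<g. p i - n0)"
    by (rule card_good_rounds_le[OF m _ p(2) final]) (use p(1) in auto)
  also have "\<dots> \<le> (\<Sum>i<g. L)"
    using p(1) by (intro sum_mono) force
  finally have "card ?G \<le> g * L" by simp
  moreover have "card ?B \<le> (\<Sum>i\<in>{g..<k}. card {n. n0 \<le> n \<and> n < n0 + T \<and> b \<le> ?r i n})"
    by (rule card_bad_rounds_le[OF m(2,3)]) (use top in auto)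
  moreover have "card ?G + card ?B = T"
  proof -
    have "?G \<union> ?B = {..<T}" by auto
    then show ?thesis
      by (subst card_Un_disjoint[symmetric]) auto
  qed
  ultimately show False
    using few by simp
qed

section \<open>Running means of standard normal sequences\<close>

abbreviation std_normal :: "real measure" where
  "std_normal \<equiv> density lborel (\<lambda>x. ennreal (std_normal_density x))"

lemma prob_space_std_normal: "prob_space std_normal"
  by (rule prob_space_normal_density) simp

text \<open>Outside \<open>I\<close> the coordinate is the constant \<open>undefined\<close>, so no
  membership condition arises and running means of every length are measurable.\<close>

lemma borel_measurable_PiM_component:
  assumes "\<And>i. i \<in> I \<Longrightarrow> sets (M i) = sets borel"
  shows "(\<lambda>x. x i) \<in> borel_measurable (PiM I M)"
proof (cases "i \<in> I")
  case True
  then show ?thesis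
    using measurable_component_singleton[OF True, of M] by (simp cong: measurable_cong_sets add: assms)
next
  case False
  then have "x i = undefined" if "x \<in> space (PiM I M)" for x
    using that by (auto simp: space_PiM PiE_def extensional_def)
  then show ?thesis
    by (subst measurable_cong[where g = "\<lambda>_. undefined"]) auto
qed

lemma borel_measurable_running_mean:
  assumes "\<And>j. (\<lambda>w. x w j) \<in> borel_measurable M"
  shows "(\<lambda>w. running_mean (x w) n) \<in> borel_measurable M"
  unfolding running_mean_def using assms by measurable

text \<open>A finite horizon is enough, because the probability bounds derived below do not depend
  on \<open>N\<close>.\<close>

definition gauss_seq :: "nat \<Rightarrow> (nat \<Rightarrow> real) measure" where
  "gauss_seq N = PiM {..<N} (\<lambda>_. std_normal)"

lemma measurable_gauss_seq [measurable]: "(\<lambda>x. x j) \<in> borel_measurable (gauss_seq N)"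
  unfolding gauss_seq_def by (rule borel_measurable_PiM_component) simp

lemma measurable_running_mean_gauss_seq [measurable]:
  "(\<lambda>x. running_mean x n) \<in> borel_measurable (gauss_seq N)"
  by (rule borel_measurable_running_mean) measurable

lemma prob_space_gauss_seq: "prob_space (gauss_seq N)"
  unfolding gauss_seq_def by (intro prob_space_PiM prob_space_std_normal)

section \<open>Exponential martingale and maximal inequality\<close>

lemma nn_integral_exp_std_normal:
  "(\<integral>\<^sup>+ y. ennreal (exp (a * y - a\<^sup>2 / 2)) \<partial>std_normal) = 1"
proof -
  \<comment> \<open>Completing the square: the exponential weight shifts the mean from 0 to
    \<open>a\<close>.\<close>
  have "std_normal_density y * exp (a * y - a\<^sup>2 / 2) = normal_density a 1 y" for y
    by (simp add: normal_density_def mult_exp_exp power2_eq_square field_simps)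
  then have "(\<integral>\<^sup>+ y. ennreal (exp (a * y - a\<^sup>2 / 2)) \<partial>std_normal) = (\<integral>\<^sup>+ y. ennreal (normal_density a 1 y) \<partial>lborel)"
    by (subst nn_integral_density) (auto simp flip: ennreal_mult)
  also have "\<dots> = 1"
    by (subst nn_integral_eq_integral) auto
  finally show ?thesis .
qed

text \<open>The martingale \<open>exp (a S\<^sub>n - n a\<^sup>2 / 2)\<close> stopped at the first \<open>p \<ge> l\<close> with \<open>a S\<^sub>p \<ge> p a\<^sup>2\<close>.\<close>

primrec stopped_exp :: "real \<Rightarrow> nat \<Rightarrow> nat \<Rightarrow> (nat \<Rightarrow> real) \<Rightarrow> real" where
  "stopped_exp a l 0 x = 1"
| "stopped_exp a l (Suc n) x =
    (if \<exists>p\<le>n. l \<le> p \<and> real p * a\<^sup>2 \<le> a * (\<Sum>j<p. x j) then stopped_exp a l n x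
     else stopped_exp a l n x * exp (a * x n - a\<^sup>2 / 2))"

lemma stopped_exp_pos: "0 < stopped_exp a l n x"
  by (induction n) auto

lemma stopped_exp_cong: "(\<And>j. j < n \<Longrightarrow> x j = y j) \<Longrightarrow> stopped_exp a l n x = stopped_exp a l n y"
proof (induction n)
  case (Suc n)
  have "(\<Sum>j<p. x j) = (\<Sum>j<p. y j)" if "p \<le> n" for p
    using Suc.prems that by (intro sum.cong) auto
  with Suc show ?case
    by (auto simp: conj_commute cong: conj_cong)
qed simp

lemma measurable_stopped_exp [measurable]: "stopped_exp a l n \<in> borel_measurable (gauss_seq N)"
proof (induction n)
  case (Suc n)
  note [measurable] = Suc
  show ?case
    unfolding stopped_exp.simps by measurable
qed (simp add: measurable_const)

text \<open>Martingale property. The last coordinate is integrated first; whether step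
  \<open>N\<close> is frozen depends only on earlier coordinates, and the factor of an unfrozen step
  has integral one.\<close>

lemma nn_integral_stopped_exp:
  "(\<integral>\<^sup>+ x. ennreal (stopped_exp a l N x) \<partial>gauss_seq N) = 1"
proof (induction N)
  case 0
  show ?case
    by (simp add: prob_space.emeasure_space_1 prob_space_gauss_seq)
next
  case (Suc N)
  interpret product_sigma_finite "\<lambda>_. std_normal"
    by (rule product_sigma_finite.intro)
      (intro prob_space_imp_sigma_finite prob_space_std_normal)
  have ins: "gauss_seq (Suc N) = PiM (insert N {..<N}) (\<lambda>_. std_normal)"
    by (simp add: gauss_seq_def lessThan_Suc)
  have "(\<integral>\<^sup>+ x. ennreal (stopped_exp a l (Suc N) x) \<partial>gauss_seq (Suc N)) =
     (\<integral>\<^sup>+ x. (\<integral>\<^sup>+ y. ennreal (stopped_exp a l (Suc N) (x(N := y))) \<partial>std_normal) \<partial>gauss_seq N)"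
    unfolding ins gauss_seq_def[of N]
    by (rule product_nn_integral_insert) (simp_all flip: ins)
  also have "\<dots> = (\<integral>\<^sup>+ x. ennreal (stopped_exp a l N x) \<partial>gauss_seq N)"
  proof (rule nn_integral_cong)
    fix x :: "nat \<Rightarrow> real"
    have sums: "(\<Sum>j<p. (x(N := y)) j) = (\<Sum>j<p. x j)" if "p \<le> N" for p y
      using that by (intro sum.cong) auto
    have stop: "stopped_exp a l N (x(N := y)) = stopped_exp a l N x" for y
      by (rule stopped_exp_cong) auto
    have hit: "(\<exists>p\<le>N. l \<le> p \<and> real p * a\<^sup>2 \<le> a * (\<Sum>j<p. (x(N := y)) j)) \<longleftrightarrow>
        (\<exists>p\<le>N. l \<le> p \<and> real p * a\<^sup>2 \<le> a * (\<Sum>j<p. x j))" for y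
      by (intro ex_cong1 conj_cong refl) (simp only: sums)
    show "(\<integral>\<^sup>+ y. ennreal (stopped_exp a l (Suc N) (x(N := y))) \<partial>std_normal) = ennreal (stopped_exp a l N x)"
    proof (cases "\<exists>p\<le>N. l \<le> p \<and> real p * a\<^sup>2 \<le> a * (\<Sum>j<p. x j)")
      case True
      then have "stopped_exp a l (Suc N) (x(N := y)) = stopped_exp a l N x" for y
        by (simp only: stopped_exp.simps hit stop if_True)
      then show ?thesis
        by (simp only: nn_integral_const prob_space.emeasure_space_1[OF prob_space_std_normal] mult_1_right)
    next
      case False
      then have "stopped_exp a l (Suc N) (x(N := y)) = stopped_exp a l N x * exp (a * y - a\<^sup>2 / 2)" for y
        by (simp only: stopped_exp.simps hit stop if_False fun_upd_same)
      then have "(\<integral>\<^sup>+ y. ennreal (stopped_exp a l (Suc N) (x(N := y))) \<partial>std_normal) =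
          (\<integral>\<^sup>+ y. ennreal (stopped_exp a l N x) * ennreal (exp (a * y - a\<^sup>2 / 2)) \<partial>std_normal)"
        by (simp only: ennreal_mult stopped_exp_pos less_imp_le exp_ge_zero)
      also have "\<dots> = ennreal (stopped_exp a l N x)"
        by (subst nn_integral_cmult) (simp_all add: nn_integral_exp_std_normal)
      finally show ?thesis .
    qed
  qed
  finally show ?case
    using Suc by simp
qed

lemma stopped_exp_before:
  assumes "\<And>p. p < n \<Longrightarrow> \<not> (l \<le> p \<and> real p * a\<^sup>2 \<le> a * (\<Sum>j<p. x j))"
  shows "stopped_exp a l n x = exp (a * (\<Sum>j<n. x j) - real n * (a\<^sup>2 / 2))"
  using assms
proof (induction n)
  case (Suc n)
  have "\<not> (\<exists>p\<le>n. l \<le> p \<and> real p * a\<^sup>2 \<le> a * (\<Sum>j<p. x j))"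
    using Suc.prems by (auto simp: less_Suc_eq_le)
  then have "stopped_exp a l (Suc n) x = stopped_exp a l n x * exp (a * x n - a\<^sup>2 / 2)"
    by (simp only: stopped_exp.simps if_False)
  also have "stopped_exp a l n x = exp (a * (\<Sum>j<n. x j) - real n * (a\<^sup>2 / 2))"
    using Suc by simp
  finally show ?case
    by (simp add: mult_exp_exp algebra_simps del: stopped_exp.simps)
qed simp

text \<open>At the first hitting time \<open>p\<close> the exponent is at least
  \<open>p a\<^sup>2 / 2\<close>, which is at least \<open>l a\<^sup>2 / 2\<close>; afterwards the
  value stays frozen.\<close>

lemma stopped_exp_ge:
  assumes "\<exists>p\<le>n. l \<le> p \<and> real p * a\<^sup>2 \<le> a * (\<Sum>j<p. x j)"
  shows "exp (real l * a\<^sup>2 / 2) \<le> stopped_exp a l n x"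
proof -
  let ?H = "\<lambda>p. l \<le> p \<and> real p * a\<^sup>2 \<le> a * (\<Sum>j<p. x j)"
  obtain q where q: "q \<le> n" "?H q"
    using assms by blast
  define p where "p = (LEAST p. ?H p)"
  have p: "?H p" "\<And>q. q < p \<Longrightarrow> \<not> ?H q" "p \<le> n"
    using LeastI[of ?H, OF q(2)] not_less_Least[of _ ?H] Least_le[of ?H, OF q(2)] q(1)
    unfolding p_def by auto
  have "stopped_exp a l n x = stopped_exp a l p x"
    using p(3)
  proof (induction n rule: dec_induct)
    case (step n)
    with p(1) show ?case by auto
  qed simp
  also have "\<dots> = exp (a * (\<Sum>j<p. x j) - real p * (a\<^sup>2 / 2))"
    by (rule stopped_exp_before) (use p in auto)
  also have "\<dots> \<ge> exp (real l * a\<^sup>2 / 2)"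
  proof -
    have "real l * a\<^sup>2 \<le> real p * a\<^sup>2"
      using p(1) by (intro mult_right_mono) auto
    then show ?thesis
      using p(1) by simp
  qed
  finally show ?thesis .
qed

text \<open>Stopping turns an event about all times up to \<open>N\<close> into one about the value
  at time \<open>N\<close>, to which Markov's inequality applies with mean one.\<close>

lemma gauss_seq_maximal_ineq:
  "measure (gauss_seq N) {x \<in> space (gauss_seq N). \<exists>p\<le>N. l \<le> p \<and> real p * a\<^sup>2 \<le> a * (\<Sum>j<p. x j)}
    \<le> exp (- (real l * a\<^sup>2 / 2))"
proof -
  interpret prob_space "gauss_seq N" by (rule prob_space_gauss_seq)
  let ?M = "gauss_seq N" and ?c = "exp (real l * a\<^sup>2 / 2)"
  have "integrable ?M (stopped_exp a l N)"
    by (rule integrableI_nonneg)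
      (auto simp: nn_integral_stopped_exp stopped_exp_pos less_imp_le)
  moreover have "integral\<^sup>L ?M (stopped_exp a l N) = 1"
    by (subst integral_eq_nn_integral)
      (auto simp: nn_integral_stopped_exp stopped_exp_pos less_imp_le)
  ultimately have "prob {x \<in> space ?M. ?c \<le> stopped_exp a l N x} \<le> 1 / ?c"
    using integral_Markov_inequality_measure[of ?M "stopped_exp a l N" "space ?M" ?c]
    by (simp add: stopped_exp_pos less_imp_le)
  moreover have "prob {x \<in> space ?M. \<exists>p\<le>N. l \<le> p \<and> real p * a\<^sup>2 \<le> a * (\<Sum>j<p. x j)}
      \<le> prob {x \<in> space ?M. ?c \<le> stopped_exp a l N x}"
    by (intro finite_measure_mono) (auto intro: stopped_exp_ge)
  ultimately show ?thesis
    by (simp add: exp_minus inverse_eq_divide)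
qed

lemma gauss_seq_mean_ge:
  assumes "0 \<le> a" "1 \<le> l"
  shows "measure (gauss_seq N) {x \<in> space (gauss_seq N). \<exists>p\<in>{l..N}. a \<le> running_mean x p}
    \<le> exp (- (real l * a\<^sup>2 / 2))"
proof -
  interpret prob_space "gauss_seq N" by (rule prob_space_gauss_seq)
  have "real p * a\<^sup>2 \<le> a * (\<Sum>j<p. x j)" if "l \<le> p" "a \<le> running_mean x p" for x p
  proof -
    have "real p * a \<le> (\<Sum>j<p. x j)"
      using that assms by (simp add: running_mean_def field_simps)
    from mult_left_mono[OF this assms(1)] show ?thesis
      by (simp add: power2_eq_square mult_ac)
  qed
  then have "prob {x \<in> space (gauss_seq N). \<exists>p\<in>{l..N}. a \<le> running_mean x p}
     \<le> prob {x \<in> space (gauss_seq N). \<exists>p\<le>N. l \<le> p \<and> real p * a\<^sup>2 \<le> a * (\<Sum>j<p. x j)}"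
    by (intro finite_measure_mono) auto
  then show ?thesis
    using gauss_seq_maximal_ineq order_trans by blast
qed

text \<open>The maximal inequality holds for either sign of \<open>a\<close>; the lower tail is the
  case \<open>- a\<close>.\<close>

lemma gauss_seq_mean_le:
  assumes "0 \<le> a" "1 \<le> l"
  shows "measure (gauss_seq N) {x \<in> space (gauss_seq N). \<exists>p\<in>{l..N}. running_mean x p \<le> - a}
    \<le> exp (- (real l * a\<^sup>2 / 2))"
proof -
  interpret prob_space "gauss_seq N" by (rule prob_space_gauss_seq)
  have "real p * (- a)\<^sup>2 \<le> - a * (\<Sum>j<p. x j)" if "l \<le> p" "running_mean x p \<le> - a" for x p
  proof -
    have "real p * a \<le> - (\<Sum>j<p. x j)"
      using that assms by (simp add: running_mean_def field_simps)
    from mult_left_mono[OF this assms(1)] show ?thesis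
      by (simp add: power2_eq_square mult_ac)
  qed
  then have "prob {x \<in> space (gauss_seq N). \<exists>p\<in>{l..N}. running_mean x p \<le> - a}
     \<le> prob {x \<in> space (gauss_seq N). \<exists>p\<le>N. l \<le> p \<and> real p * (- a)\<^sup>2 \<le> - a * (\<Sum>j<p. x j)}"
    by (intro finite_measure_mono) auto
  then show ?thesis
    using gauss_seq_maximal_ineq[of N l "- a"] by simp
qed

section \<open>Independence of coordinates and laws of block sums\<close>

lemma indep_vars_PiM_components:
  assumes "I \<noteq> {}" and prob: "\<And>i. i \<in> I \<Longrightarrow> prob_space (M i)"
  shows "prob_space.indep_vars (PiM I M) M (\<lambda>i x. x i) I"
proof -
  interpret prob_space "PiM I M" by (intro prob_space_PiM prob)
  have "distr (PiM I M) (PiM I M) (\<lambda>x. \<lambda>i\<in>I. x i) = distr (PiM I M) (PiM I M) (\<lambda>x. x)"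
    by (rule distr_cong) (simp_all add: space_PiM PiE_restrict)
  also have "\<dots> = PiM I M"
    by (rule distr_id)
  also have "\<dots> = PiM I (\<lambda>i. distr (PiM I M) (M i) (\<lambda>x. x i))"
    by (rule PiM_cong[OF refl]) (rule distr_PiM_component[symmetric], auto intro: prob)
  finally show ?thesis
    by (subst indep_vars_iff_distr_eq_PiM'[of I "\<lambda>i x. x i" M])
      (use assms(1) in \<open>simp_all only: measurable_component_singleton not_False_eq_True\<close>)
qed

lemma gauss_seq_indep_vars:
  assumes "0 < N"
  shows "prob_space.indep_vars (gauss_seq N) (\<lambda>_. borel) (\<lambda>j x. x j) {..<N}"
proof -
  interpret prob_space "gauss_seq N" by (rule prob_space_gauss_seq)
  have "indep_vars (\<lambda>_. std_normal) (\<lambda>j x. x j) {..<N}"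
    using assms unfolding gauss_seq_def
    by (intro indep_vars_PiM_components prob_space_std_normal) auto
  then show ?thesis
    by (rule indep_vars_compose2[where Y = "\<lambda>_ x. x"]) simp
qed

lemma gauss_seq_distributed:
  assumes "j < N"
  shows "distributed (gauss_seq N) lborel (\<lambda>x. x j) std_normal_density"
proof -
  have "distr (gauss_seq N) std_normal (\<lambda>x. x j) = std_normal"
    unfolding gauss_seq_def using assms by (intro distr_PiM_component prob_space_std_normal) auto
  then have "distr (gauss_seq N) lborel (\<lambda>x. x j) = std_normal"
    by (metis distr_cong sets_density)
  then show ?thesis
    by (simp add: distributed_def)
qed

lemma gauss_seq_sum_distributed:
  assumes "a < b" "b \<le> N"
  shows "distributed (gauss_seq N) lborel (\<lambda>x. \<Sum>j\<in>{a..<b}. x j) (normal_density 0 (sqrt (real (b - a))))"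
proof -
  interpret prob_space "gauss_seq N" by (rule prob_space_gauss_seq)
  have "distributed (gauss_seq N) lborel (\<lambda>x. \<Sum>j\<in>{a..<b}. x j)
      (normal_density (\<Sum>j\<in>{a..<b}. 0) (sqrt (\<Sum>j\<in>{a..<b}. 1\<^sup>2)))"
  proof (rule sum_indep_normal)
    show "indep_vars (\<lambda>_. borel) (\<lambda>j x. x j) {a..<b}"
      by (rule indep_vars_subset[OF gauss_seq_indep_vars]) (use assms in auto)
    show "distributed (gauss_seq N) lborel (\<lambda>x. x j) (\<lambda>x. ennreal (std_normal_density x))" if "j \<in> {a..<b}" for j
      using that assms by (intro gauss_seq_distributed) auto
  qed (use assms in auto)
  then show ?thesis
    using assms by simp
qed

text \<open>The density is strictly positive, so a null half line would be Lebesgue null, yet it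
  contains an interval of length one.\<close>

lemma std_normal_less_neg_one_pos: "0 < measure std_normal {..<-1}"
proof -
  interpret prob_space std_normal by (rule prob_space_std_normal)
  have "emeasure std_normal {..<-1} \<noteq> 0"
  proof
    assume "emeasure std_normal {..<-1} = 0"
    then have "AE x in lborel. x \<in> {..<-1} \<longrightarrow> ennreal (std_normal_density x) = 0"
      by (subst (asm) emeasure_density) (auto simp: nn_integral_0_iff_AE indicator_def elim!: eventually_mono)
    then have "AE x in lborel. x \<notin> {..<-1::real}"
      by (rule eventually_mono) (use normal_density_pos[of 1 0] in \<open>auto simp: less_le\<close>)
    then have "emeasure lborel {..<-1::real} = 0"
      by (subst (asm) AE_iff_null_sets[symmetric]) (simp_all add: null_sets_def)
    moreover have "emeasure lborel {-3<..<-2::real} \<le> emeasure lborel {..<-1::real}"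
      by (intro emeasure_mono) auto
    ultimately show False by simp
  qed
  then show ?thesis
    by (simp add: emeasure_eq_measure zero_less_measure_iff)
qed

lemma gauss_seq_block_prob:
  assumes "a < b" "b \<le> N"
  shows "measure (gauss_seq N) {x \<in> space (gauss_seq N). - sqrt (real (b - a)) \<le> (\<Sum>j\<in>{a..<b}. x j)}
    = 1 - measure std_normal {..<-1}"
proof -
  interpret prob_space "gauss_seq N" by (rule prob_space_gauss_seq)
  interpret std: prob_space std_normal by (rule prob_space_std_normal)
  let ?s = "sqrt (real (b - a))" and ?D = "\<lambda>x. \<Sum>j\<in>{a..<b}. x j"
  have s: "0 < ?s" using assms by simp
  have "distributed (gauss_seq N) lborel (\<lambda>x. (?D x - 0) / ?s) std_normal_density"
    using gauss_seq_sum_distributed[OF assms] normal_standard_normal_convert[OF s, of ?D 0] by simp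
  then have d: "distr (gauss_seq N) lborel (\<lambda>x. ?D x / ?s) = std_normal"
    by (simp add: distributed_def)
  have "{x \<in> space (gauss_seq N). - ?s \<le> ?D x} = (\<lambda>x. ?D x / ?s) -` {-1..} \<inter> space (gauss_seq N)"
    using s by (auto simp: field_simps)
  then have "prob {x \<in> space (gauss_seq N). - ?s \<le> ?D x} = measure (distr (gauss_seq N) lborel (\<lambda>x. ?D x / ?s)) {-1..}"
    by (subst measure_distr) auto
  also have "\<dots> = measure std_normal (space std_normal - {..<-1})"
    unfolding d by (rule arg_cong[where f = "measure std_normal"]) auto
  also have "\<dots> = 1 - measure std_normal {..<-1}"
    by (rule std.prob_compl) simp
  finally show ?thesis .
qed

text \<open>Sums over disjoint blocks are independent, and each normalized block sum is standard
  normal.\<close>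

lemma gauss_seq_blocks_prob:
  assumes "strict_mono e" "e K \<le> N" "0 < K"
  shows "measure (gauss_seq N) {x \<in> space (gauss_seq N).
      \<forall>r<K. - sqrt (real (e (Suc r) - e r)) \<le> (\<Sum>j\<in>{e r..<e (Suc r)}. x j)}
    = (1 - measure std_normal {..<-1}) ^ K"
proof -
  interpret prob_space "gauss_seq N" by (rule prob_space_gauss_seq)
  let ?D = "\<lambda>r x. \<Sum>j\<in>{e r..<e (Suc r)}. x j"
  have e_le: "e r \<le> N" if "r \<le> K" for r
    using that assms strict_mono_less_eq[OF assms(1), of r K] by linarith
  have N: "0 < N"
    using assms strict_mono_less[OF assms(1), of 0 K] by simp
  have disj: "disjoint_family_on (\<lambda>r. {e r..<e (Suc r)}) {..<K}"
    unfolding disjoint_family_on_def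
  proof (intro ballI impI)
    fix r s :: nat assume "r \<noteq> s"
    then have "Suc r \<le> s \<or> Suc s \<le> r"
      by linarith
    then have "e (Suc r) \<le> e s \<or> e (Suc s) \<le> e r"
      using strict_mono_less_eq[OF assms(1), of "Suc r" s] strict_mono_less_eq[OF assms(1), of "Suc s" r]
      by blast
    then show "{e r..<e (Suc r)} \<inter> {e s..<e (Suc s)} = {}" by auto
  qed
  have "indep_vars (\<lambda>r. PiM {e r..<e (Suc r)} (\<lambda>_. borel)) (\<lambda>r x. restrict (\<lambda>j. x j) {e r..<e (Suc r)}) {..<K}"
  proof (rule indep_vars_restrict[OF gauss_seq_indep_vars[OF N] _ disj])
    show "{e r..<e (Suc r)} \<subseteq> {..<N}" if "r \<in> {..<K}" for r
      using that e_le[of "Suc r"] by auto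
  qed
  then have "indep_vars (\<lambda>_. borel) (\<lambda>r x. \<Sum>j\<in>{e r..<e (Suc r)}. restrict (\<lambda>j. x j) {e r..<e (Suc r)} j) {..<K}"
    by (rule indep_vars_compose2[where Y = "\<lambda>r f. \<Sum>j\<in>{e r..<e (Suc r)}. f j"]) measurable
  then have ind: "indep_vars (\<lambda>_. borel) ?D {..<K}"
    by simp
  let ?A = "\<lambda>r. {- sqrt (real (e (Suc r) - e r))..}"
  have "{x \<in> space (gauss_seq N). \<forall>r<K. - sqrt (real (e (Suc r) - e r)) \<le> ?D r x}
      = (\<Inter>r\<in>{..<K}. ?D r -` ?A r \<inter> space (gauss_seq N))"
    using assms(3) by auto
  also have "prob \<dots> = (\<Prod>r\<in>{..<K}. prob (?D r -` ?A r \<inter> space (gauss_seq N)))"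
    using assms(3) by (intro indep_varsD_finite[OF ind]) auto
  also have "\<dots> = (\<Prod>r\<in>{..<K}. 1 - measure std_normal {..<-1})"
  proof (rule prod.cong[OF refl])
    fix r assume "r \<in> {..<K}"
    then have "e r < e (Suc r)" "e (Suc r) \<le> N"
      using e_le[of "Suc r"] strict_mono_less[OF assms(1), of r "Suc r"] by auto
    from gauss_seq_block_prob[OF this]
    show "prob (?D r -` ?A r \<inter> space (gauss_seq N)) = 1 - measure std_normal {..<-1}"
      by (simp add: vimage_def Int_def conj_commute)
  qed
  finally show ?thesis by simp
qed

text \<open>Over geometrically growing blocks, some block sum lies below minus one standard deviation,
  and this outweighs the partial sum before the block.\<close>

lemma gauss_seq_dips_below_mean:
  assumes n0: "1 \<le> n0" and eps: "0 < \<epsilon>"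
  obtains L \<eta> where "n0 \<le> L" "0 < \<eta>"
    "\<And>N. L \<le> N \<Longrightarrow> measure (gauss_seq N) {x \<in> space (gauss_seq N). \<forall>n\<in>{n0..L}. - \<eta> < running_mean x n} \<le> \<epsilon>"
proof -
  define p where "p = measure std_normal {..<-1}"
  interpret std: prob_space std_normal by (rule prob_space_std_normal)
  have p: "0 < p" "p \<le> 1"
    by (simp_all add: p_def std_normal_less_neg_one_pos)
  \<comment> \<open>The number of blocks is chosen so that, except with probability
    \<open>\<epsilon> / 2\<close>, at least one block sum dips.\<close>
  obtain K0 where K0: "(1 - p) ^ K0 < \<epsilon> / 2"
    using real_arch_pow_inv[of "\<epsilon> / 2" "1 - p"] eps p by auto
  define K where "K = Suc K0"
  have "(1 - p) ^ K \<le> (1 - p) ^ K0"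
    unfolding K_def using p by (intro power_decreasing) auto
  with K0 have K: "(1 - p) ^ K \<le> \<epsilon> / 2" "0 < K"
    by (auto simp: K_def)
  \<comment> \<open>The remaining \<open>\<epsilon> / 2\<close> is spent on \<open>K\<close> partial
    sums exceeding \<open>c\<close> standard deviations; \<open>exp y \<ge> y\<close> at
    \<open>y = 2 K / \<epsilon>\<close> gives the bound.\<close>
  define c where "c = sqrt (4 * real K / \<epsilon>)"
  have c: "0 \<le> c" "c\<^sup>2 = 4 * real K / \<epsilon>"
    using eps by (simp_all add: c_def)
  have cK: "real K * exp (- (c\<^sup>2 / 2)) \<le> \<epsilon> / 2"
  proof -
    have "2 * real K / \<epsilon> \<le> exp (2 * real K / \<epsilon>)"
      using exp_ge_add_one_self[of "2 * real K / \<epsilon>"] by linarith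
    then show ?thesis
      using eps by (simp add: c exp_minus field_simps)
  qed
  \<comment> \<open>The growth ratio makes the standard deviation of a block at least
    \<open>c + 1\<close> times that of the partial sum before it.\<close>
  define q where "q = nat \<lceil>(c + 1)\<^sup>2\<rceil> + 1"
  have q: "(c + 1)\<^sup>2 \<le> real q - 1" "1 < q"
  proof -
    show "(c + 1)\<^sup>2 \<le> real q - 1"
      by (simp add: q_def)
    moreover have "1\<^sup>2 \<le> (c + 1)\<^sup>2"
      using c by (intro power_mono) auto
    ultimately show "1 < q"
      by simp
  qed
  define e where "e r = n0 * q ^ r" for r
  have e_pos: "1 \<le> e r" for r
    using n0 q by (simp add: e_def Suc_le_eq)
  have e_mono: "strict_mono e"
    unfolding strict_mono_Suc_iff using n0 q by (auto simp: e_def)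
  have e0: "n0 \<le> e r" for r
    using strict_mono_less_eq[OF e_mono, of 0 r] by (simp add: e_def)
  have eK: "e r \<le> e K" if "r \<le> K" for r
    using strict_mono_less_eq[OF e_mono] that by simp
  have len: "(c + 1) * sqrt (real (e r)) \<le> sqrt (real (e (Suc r) - e r))" for r
  proof -
    have "real (e (Suc r) - e r) = real (e r) * (real q - 1)"
      using strict_mono_less_eq[OF e_mono, of r "Suc r"] by (simp add: of_nat_diff e_def algebra_simps)
    also have "\<dots> \<ge> real (e r) * (c + 1)\<^sup>2"
      using q by (intro mult_left_mono) auto
    finally have "sqrt (real (e r) * (c + 1)\<^sup>2) \<le> sqrt (real (e (Suc r) - e r))"
      by simp
    then show ?thesis
      using c by (simp add: real_sqrt_mult mult_ac)
  qed
  show thesis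
  \<comment> \<open>A sum below -1 over at most \<open>e K\<close> terms has mean below
    \<open>- 1 / e K\<close>, hence this \<open>\<eta>\<close>.\<close>
  proof (rule that[of "e K" "1 / real (e K)"])
    fix N assume N: "e K \<le> N"
    interpret prob_space "gauss_seq N" by (rule prob_space_gauss_seq)
    let ?M = "gauss_seq N"
    let ?D = "\<lambda>r x. \<Sum>j\<in>{e r..<e (Suc r)}. x j"
    let ?A = "{x \<in> space ?M. \<forall>r<K. - sqrt (real (e (Suc r) - e r)) \<le> ?D r x}"
    let ?C = "\<lambda>r. {x \<in> space ?M. \<exists>n\<in>{e r..N}. c / sqrt (real (e r)) \<le> running_mean x n}"
    have "{x \<in> space ?M. \<forall>n\<in>{n0..e K}. - (1 / real (e K)) < running_mean x n} \<subseteq> ?A \<union> (\<Union>r<K. ?C r)"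
    proof safe
      fix x r assume x: "x \<in> space ?M" and dip: "\<forall>n\<in>{n0..e K}. - (1 / real (e K)) < running_mean x n"
        and C: "x \<notin> (\<Union>r<K. ?C r)" and r: "r < K"
      show "- sqrt (real (e (Suc r) - e r)) \<le> ?D r x"
      proof (rule ccontr)
        assume D: "\<not> ?thesis"
        have "e r \<in> {e r..N}"
          using eK[of r] N r by simp
        with C r x have "running_mean x (e r) < c / sqrt (real (e r))"
          by force
        then have "(\<Sum>j<e r. x j) < c / sqrt (real (e r)) * real (e r)"
          using e_pos[of r] by (simp add: running_mean_def pos_divide_less_eq)
        also have "\<dots> = c * sqrt (real (e r))"
          by (metis real_div_sqrt of_nat_0_le_iff times_divide_eq_left times_divide_eq_right)
        finally have S: "(\<Sum>j<e r. x j) < c * sqrt (real (e r))" .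
        have split: "(\<Sum>j<e (Suc r). x j) = (\<Sum>j<e r. x j) + ?D r x"
          using strict_mono_less_eq[OF e_mono, of r "Suc r"]
          by (simp add: lessThan_atLeast0 sum.atLeastLessThan_concat)
        have "1 \<le> sqrt (real (e r))"
          using e_pos[of r] by simp
        moreover have "sqrt (real (e r)) + c * sqrt (real (e r)) \<le> sqrt (real (e (Suc r) - e r))"
          using len[of r] by (simp add: algebra_simps)
        \<comment> \<open>The block contributes less than \<open>- (c + 1) sqrt (e r)\<close> and
          the part before it less than \<open>c sqrt (e r)\<close>, which leaves less than
          \<open>- sqrt (e r) \<le> - 1\<close>.\<close>
        ultimately have neg: "(\<Sum>j<e (Suc r). x j) < - 1"
          using S D split by linarith
        have "- (1 / real (e K)) < running_mean x (e (Suc r))"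
          using dip e0[of "Suc r"] eK[of "Suc r"] r by simp
        then have "- 1 < running_mean x (e (Suc r)) * real (e K)"
          using e_pos[of K] by (simp add: field_simps)
        also have "\<dots> \<le> running_mean x (e (Suc r)) * real (e (Suc r))"
          using neg eK[of "Suc r"] r e_pos[of "Suc r"]
          by (intro mult_left_mono_neg) (auto simp: running_mean_def divide_le_0_iff)
        also have "\<dots> = (\<Sum>j<e (Suc r). x j)"
          using e_pos[of "Suc r"] by (simp add: running_mean_def)
        finally show False
          using neg by simp
      qed
    qed
    then have "prob {x \<in> space ?M. \<forall>n\<in>{n0..e K}. - (1 / real (e K)) < running_mean x n} \<le> prob (?A \<union> (\<Union>r<K. ?C r))"
      by (intro finite_measure_mono) auto
    also have "\<dots> \<le> prob ?A + prob (\<Union>r<K. ?C r)"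
      by (intro measure_Un_le) auto
    also have "prob (\<Union>r<K. ?C r) \<le> (\<Sum>r<K. prob (?C r))"
      by (intro finite_measure_subadditive_finite) auto
    also have "\<dots> \<le> (\<Sum>r<K. exp (- (c\<^sup>2 / 2)))"
    proof (rule sum_mono)
      fix r assume "r \<in> {..<K}"
      have "prob (?C r) \<le> exp (- (real (e r) * (c / sqrt (real (e r)))\<^sup>2 / 2))"
        using c e_pos[of r] by (intro gauss_seq_mean_ge) auto
      also have "real (e r) * (c / sqrt (real (e r)))\<^sup>2 = c\<^sup>2"
        using e_pos[of r] by (simp add: power_divide)
      finally show "prob (?C r) \<le> exp (- (c\<^sup>2 / 2))" .
    qed
    also have "\<dots> = real K * exp (- (c\<^sup>2 / 2))"
      by simp
    also have "prob ?A = (1 - p) ^ K"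
      unfolding p_def by (rule gauss_seq_blocks_prob[OF e_mono N K(2)])
    finally show "prob {x \<in> space ?M. \<forall>n\<in>{n0..e K}. - (1 / real (e K)) < running_mean x n} \<le> \<epsilon>"
      using K cK by linarith
  qed (use e0 e_pos[of K] in auto)
qed

text \<open>Some mean falls to \<open>- \<eta>\<close> by time \<open>L0\<close>, whereas from time
  \<open>L\<close> on all means stay above \<open>- \<eta>\<close>, each up to probability
  \<open>\<epsilon> / 2\<close>. No later mean can then undercut the window.\<close>

lemma gauss_seq_argmin_tight:
  assumes n0: "1 \<le> n0" and eps: "0 < \<epsilon>"
  obtains L where "n0 \<le> L"
    "\<And>N. L \<le> N \<Longrightarrow> measure (gauss_seq N) {x \<in> space (gauss_seq N).
       \<exists>n\<in>{n0..N}. \<forall>p\<in>{n0..L}. running_mean x n < running_mean x p} \<le> \<epsilon>"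
proof -
  obtain L0 \<eta> where L0: "n0 \<le> L0" "0 < \<eta>"
    "\<And>N. L0 \<le> N \<Longrightarrow> measure (gauss_seq N) {x \<in> space (gauss_seq N). \<forall>n\<in>{n0..L0}. - \<eta> < running_mean x n} \<le> \<epsilon> / 2"
    using gauss_seq_dips_below_mean[OF n0, of "\<epsilon> / 2"] eps by auto
  \<comment> \<open>This makes \<open>L \<eta>\<^sup>2 / 2\<close> at least
    \<open>2 / \<epsilon>\<close>, and \<open>exp y \<ge> y\<close> bounds the late deviations by
    \<open>\<epsilon> / 2\<close>.\<close>
  define L where "L = max L0 (nat \<lceil>4 / (\<epsilon> * \<eta>\<^sup>2)\<rceil>)"
  have L: "L0 \<le> L" "4 / (\<epsilon> * \<eta>\<^sup>2) \<le> real L"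
    by (auto simp: L_def intro: order_trans[OF real_nat_ceiling_ge])
  have expL: "exp (- (real L * \<eta>\<^sup>2 / 2)) \<le> \<epsilon> / 2"
  proof -
    have "2 / \<epsilon> \<le> real L * \<eta>\<^sup>2 / 2"
      using L(2) L0(2) eps by (simp add: field_simps)
    also have "\<dots> \<le> exp (real L * \<eta>\<^sup>2 / 2)"
      using exp_ge_add_one_self[of "real L * \<eta>\<^sup>2 / 2"] by linarith
    finally show ?thesis
      using eps by (simp add: exp_minus field_simps)
  qed
  show thesis
  proof (rule that[of L])
    fix N assume N: "L \<le> N"
    interpret prob_space "gauss_seq N" by (rule prob_space_gauss_seq)
    let ?M = "gauss_seq N"
    let ?A = "{x \<in> space ?M. \<forall>n\<in>{n0..L0}. - \<eta> < running_mean x n}"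
    let ?C = "{x \<in> space ?M. \<exists>n\<in>{L..N}. running_mean x n \<le> - \<eta>}"
    let ?E = "{x \<in> space ?M. \<exists>n\<in>{n0..N}. \<forall>p\<in>{n0..L}. running_mean x n < running_mean x p}"
    have "?E \<subseteq> ?A \<union> ?C"
    proof safe
      fix x n m assume x: "x \<in> space ?M" and n: "n \<in> {n0..N}" "\<forall>p\<in>{n0..L}. running_mean x n < running_mean x p"
        and C: "\<not> (\<exists>n\<in>{L..N}. running_mean x n \<le> - \<eta>)" and m: "m \<in> {n0..L0}"
      have "n \<notin> {n0..L}"
        using n(2) by blast
      with n(1) C have "- \<eta> < running_mean x n"
        by (auto simp: not_le)
      also have "\<dots> < running_mean x m"
        using n(2) m L by auto
      finally show "- \<eta> < running_mean x m" .
    qed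
    then have "prob ?E \<le> prob (?A \<union> ?C)"
      by (intro finite_measure_mono) auto
    also have "\<dots> \<le> prob ?A + prob ?C"
      by (intro measure_Un_le) auto
    also have "prob ?A \<le> \<epsilon> / 2"
      using L N by (intro L0) auto
    also have "prob ?C \<le> exp (- (real L * \<eta>\<^sup>2 / 2))"
      using L0 L n0 by (intro gauss_seq_mean_le) auto
    finally show "prob ?E \<le> \<epsilon>"
      using expL by simp
  qed (use L0 L in simp)
qed

section \<open>Rows of the observation space\<close>

text \<open>The restriction to \<open>{..<N}\<close> makes the standardized row extensional, hence a
  point of the space of \<open>gauss_seq N\<close>.\<close>

definition std_row :: "(nat \<Rightarrow> real) \<Rightarrow> (nat \<Rightarrow> real) \<Rightarrow> nat \<Rightarrow> nat \<Rightarrow> (nat \<times> nat \<Rightarrow> real) \<Rightarrow> nat \<Rightarrow> real" where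
  "std_row \<mu> \<sigma> N i X = (\<lambda>j\<in>{..<N}. (X (i, j) - \<mu> i) / \<sigma> i)"

text \<open>An increasing affine relation, so comparisons between running means within a row, and
  with them argmin times, carry over from the standardized row.\<close>

lemma running_mean_std_row:
  assumes "0 < \<sigma> i" "1 \<le> n" "n \<le> N"
  shows "running_mean (\<lambda>j. X (i, j)) n = \<mu> i + \<sigma> i * running_mean (std_row \<mu> \<sigma> N i X) n"
proof -
  have "(\<Sum>j<n. std_row \<mu> \<sigma> N i X j) = (\<Sum>j<n. (X (i, j) - \<mu> i) / \<sigma> i)"
    using assms by (intro sum.cong) (auto simp: std_row_def)
  also have "\<dots> = ((\<Sum>j<n. X (i, j)) - real n * \<mu> i) / \<sigma> i"
    by (simp add: sum_subtractf flip: sum_divide_distrib)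
  finally show ?thesis
    using assms by (simp add: running_mean_def field_simps)
qed

lemma measurable_obs_space_component [measurable]:
  "(\<lambda>X. X p) \<in> borel_measurable (obs_space \<mu> \<sigma> k N)"
  unfolding obs_space_def by (rule borel_measurable_PiM_component) auto

lemma measurable_std_row [measurable]:
  "std_row \<mu> \<sigma> N i \<in> measurable (obs_space \<mu> \<sigma> k N) (gauss_seq N)"
proof -
  have "(\<lambda>X. \<lambda>j\<in>{..<N}. (X (i, j) - \<mu> i) / \<sigma> i) \<in> measurable (obs_space \<mu> \<sigma> k N) (gauss_seq N)"
    unfolding gauss_seq_def by (rule measurable_restrict) simp
  then show ?thesis
    by (simp add: std_row_def[abs_def])
qed

text \<open>Positivity of \<open>N\<close> and \<open>k\<close> makes the index set nonempty, as
  \<open>indep_vars_PiM_components\<close> requires.\<close>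

locale gauss_obs =
  fixes \<mu> \<sigma> :: "nat \<Rightarrow> real" and k N :: nat
  assumes pos: "\<And>i. i < k \<Longrightarrow> 0 < \<sigma> i" and N_pos: "0 < N" and k_pos: "0 < k"
begin

abbreviation "M \<equiv> obs_space \<mu> \<sigma> k N"
abbreviation "zrow \<equiv> std_row \<mu> \<sigma> N"

sublocale prob_space M
  unfolding obs_space_def by (rule prob_space_PiM) (auto intro!: prob_space_normal_density pos)

lemma indep_components:
  "indep_vars (\<lambda>_. borel) (\<lambda>p X. X p) ({..<k} \<times> {..<N})"
proof -
  have "indep_vars (\<lambda>(i, j). density lborel (normal_density (\<mu> i) (\<sigma> i))) (\<lambda>p X. X p) ({..<k} \<times> {..<N})"
    unfolding obs_space_def
    by (rule indep_vars_PiM_components) (use N_pos k_pos pos in \<open>auto intro!: prob_space_normal_density\<close>)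
  then show ?thesis
    by (rule indep_vars_compose2[where Y = "\<lambda>_ x. x"]) auto
qed

lemma indep_rows: "indep_vars (\<lambda>_. gauss_seq N) zrow {..<k}"
proof -
  have "indep_vars (\<lambda>i. PiM ({i} \<times> {..<N}) (\<lambda>_. borel)) (\<lambda>i X. restrict (\<lambda>p. X p) ({i} \<times> {..<N})) {..<k}"
    by (rule indep_vars_restrict[OF indep_components]) (auto simp: disjoint_family_on_def)
  then have "indep_vars (\<lambda>_. gauss_seq N) (\<lambda>i X. \<lambda>j\<in>{..<N}. (restrict (\<lambda>p. X p) ({i} \<times> {..<N}) (i, j) - \<mu> i) / \<sigma> i) {..<k}"
  proof (rule indep_vars_compose2[where Y = "\<lambda>i f. \<lambda>j\<in>{..<N}. (f (i, j) - \<mu> i) / \<sigma> i"])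
    fix i :: nat
    have [measurable]: "(\<lambda>f. f (i, j)) \<in> borel_measurable (PiM ({i} \<times> {..<N}) (\<lambda>_. borel))" for j
      by (rule borel_measurable_PiM_component) simp
    show "(\<lambda>f. \<lambda>j\<in>{..<N}. (f (i, j) - \<mu> i) / \<sigma> i) \<in> measurable (PiM ({i} \<times> {..<N}) (\<lambda>_. borel)) (gauss_seq N)"
      unfolding gauss_seq_def by (rule measurable_restrict) simp
  qed
  moreover have "(\<lambda>j\<in>{..<N}. (restrict (\<lambda>p. X p) ({i} \<times> {..<N}) (i, j) - \<mu> i) / \<sigma> i) = zrow i X" for i X
    by (auto simp: std_row_def)
  ultimately show ?thesis
    by simp
qed

text \<open>Selecting a row reindexes the product along the injection
  \<open>j \<mapsto> (i, j)\<close>; standardizing its independent coordinates one by one keeps them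
  independent and makes them standard normal.\<close>

lemma distr_row:
  assumes "i < k"
  shows "distr M (gauss_seq N) (zrow i) = gauss_seq N"
proof -
  let ?D = "\<lambda>(i, j). density lborel (\<lambda>x. ennreal (normal_density (\<mu> i) (\<sigma> i) x))"
  let ?R = "PiM {..<N} (\<lambda>j. ?D (i, j))"
  let ?st = "\<lambda>y. (y - \<mu> i) / \<sigma> i"
  have prob_D: "prob_space (?D (i, j))" for j
    using prob_space_normal_density[OF pos[OF assms]] by simp
  interpret R: prob_space ?R
    by (rule prob_space_PiM) (rule prob_D)
  have meas: "(\<lambda>x. ?st (x j)) \<in> measurable ?R std_normal" for j
    using borel_measurable_PiM_component[of "{..<N}" "\<lambda>j. ?D (i, j)" j] by simp
  have "R.indep_vars (\<lambda>j. ?D (i, j)) (\<lambda>j x. x j) {..<N}"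
    by (rule indep_vars_PiM_components) (use N_pos prob_D in auto)
  then have "R.indep_vars (\<lambda>_. std_normal) (\<lambda>j x. ?st (x j)) {..<N}"
    by (rule R.indep_vars_compose2[where Y = "\<lambda>_. ?st"]) simp
  then have "distr ?R (PiM {..<N} (\<lambda>_. std_normal)) (\<lambda>x. \<lambda>j\<in>{..<N}. ?st (x j)) =
      PiM {..<N} (\<lambda>j. distr ?R std_normal (\<lambda>x. ?st (x j)))"
    using N_pos meas by (subst (asm) R.indep_vars_iff_distr_eq_PiM') auto
  also have "\<dots> = gauss_seq N"
    unfolding gauss_seq_def
  proof (rule PiM_cong[OF refl])
    fix j assume j: "j \<in> {..<N}"
    have "distr ?R (?D (i, j)) (\<lambda>x. x j) = ?D (i, j)"
      by (rule distr_PiM_component) (use j prob_D in auto)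
    moreover have "distr ?R (?D (i, j)) (\<lambda>x. x j) = distr ?R lborel (\<lambda>x. x j)"
      by (rule distr_cong) auto
    moreover have "(\<lambda>x. x j) \<in> borel_measurable ?R"
      by (rule borel_measurable_PiM_component) simp
    ultimately have "distributed ?R lborel (\<lambda>x. x j) (normal_density (\<mu> i) (\<sigma> i))"
      by (simp add: distributed_def)
    then have "distributed ?R lborel (\<lambda>x. ?st (x j)) std_normal_density"
      using R.normal_standard_normal_convert[OF pos[OF assms]] by simp
    then have "distr ?R lborel (\<lambda>x. ?st (x j)) = std_normal"
      by (simp add: distributed_def)
    moreover have "distr ?R lborel (\<lambda>x. ?st (x j)) = distr ?R std_normal (\<lambda>x. ?st (x j))"
      by (rule distr_cong) auto
    ultimately show "distr ?R std_normal (\<lambda>x. ?st (x j)) = std_normal"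
      by simp
  qed
  finally have st: "distr ?R (gauss_seq N) (\<lambda>x. \<lambda>j\<in>{..<N}. ?st (x j)) = gauss_seq N"
    by (simp add: gauss_seq_def)
  have R: "distr M ?R (\<lambda>X. \<lambda>j\<in>{..<N}. X (i, j)) = ?R"
    unfolding obs_space_def
    by (rule distr_PiM_reindex)
      (use assms pos in \<open>auto simp: inj_on_def intro!: prob_space_normal_density\<close>)
  have "distr (distr M ?R (\<lambda>X. \<lambda>j\<in>{..<N}. X (i, j))) (gauss_seq N) (\<lambda>x. \<lambda>j\<in>{..<N}. ?st (x j))
      = distr M (gauss_seq N) ((\<lambda>x. \<lambda>j\<in>{..<N}. ?st (x j)) \<circ> (\<lambda>X. \<lambda>j\<in>{..<N}. X (i, j)))"
  proof (rule distr_distr)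
    show "(\<lambda>x. \<lambda>j\<in>{..<N}. ?st (x j)) \<in> measurable ?R (gauss_seq N)"
      unfolding gauss_seq_def by (rule measurable_restrict) (rule meas)
    show "(\<lambda>X. \<lambda>j\<in>{..<N}. X (i, j)) \<in> measurable M ?R"
      by (rule measurable_restrict) simp
  qed
  also have "(\<lambda>x. \<lambda>j\<in>{..<N}. ?st (x j)) \<circ> (\<lambda>X. \<lambda>j\<in>{..<N}. X (i, j)) = zrow i"
    by (auto simp: std_row_def fun_eq_iff)
  finally show ?thesis
    unfolding R st ..
qed

lemma prob_row:
  assumes "i < k" "{x \<in> space (gauss_seq N). P x} \<in> sets (gauss_seq N)"
  shows "prob {X \<in> space M. P (zrow i X)} = measure (gauss_seq N) {x \<in> space (gauss_seq N). P x}"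
proof -
  have "measure (gauss_seq N) {x \<in> space (gauss_seq N). P x} =
      measure (distr M (gauss_seq N) (zrow i)) {x \<in> space (gauss_seq N). P x}"
    by (simp add: distr_row assms)
  also have "\<dots> = prob (zrow i -` {x \<in> space (gauss_seq N). P x} \<inter> space M)"
    using assms by (intro measure_distr) auto
  also have "zrow i -` {x \<in> space (gauss_seq N). P x} \<inter> space M = {X \<in> space M. P (zrow i X)}"
    using measurable_space[OF measurable_std_row] by blast
  finally show ?thesis by simp
qed

end

section \<open>Exceedance counts and their weak law\<close>

text \<open>A real sum of indicators instead of a cardinality, so that measurability and linearity
  of expectation apply directly.\<close>

definition exceed_count :: "real \<Rightarrow> nat set \<Rightarrow> (nat \<Rightarrow> real) \<Rightarrow> real" where
  "exceed_count a A x = (\<Sum>n\<in>A. if a \<le> running_mean x n then 1 else 0)"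

lemma measurable_exceed_count [measurable]:
  "exceed_count a A \<in> borel_measurable (gauss_seq N)"
  unfolding exceed_count_def[abs_def] by measurable

lemma exceed_count_card: "finite A \<Longrightarrow> exceed_count a A x = real (card {n \<in> A. a \<le> running_mean x n})"
  by (simp add: exceed_count_def sum.If_cases Int_def)

lemma exceed_count_nonneg: "0 \<le> exceed_count a A x"
  by (simp add: exceed_count_def sum_nonneg)

lemma exceed_count_le: "exceed_count a A x \<le> real (card A)"
  unfolding exceed_count_def by (rule order_trans[OF sum_mono[where g = "\<lambda>_. 1"]]) auto

text \<open>By linearity the expectation is a sum of tail probabilities, dominated by a geometric
  series of ratio \<open>exp (- a\<^sup>2 / 2)\<close>.\<close>

lemma integral_exceed_count_le:
  assumes a: "0 < a" and l: "1 \<le> l" "u \<le> N"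
  shows "integral\<^sup>L (gauss_seq N) (exceed_count a {l..<u}) \<le> exp (- (a\<^sup>2 / 2)) ^ l / (1 - exp (- (a\<^sup>2 / 2)))"
proof -
  interpret prob_space "gauss_seq N" by (rule prob_space_gauss_seq)
  let ?q = "exp (- (a\<^sup>2 / 2))"
  have q: "0 < ?q" "?q < 1" using a by auto
  have "integral\<^sup>L (gauss_seq N) (exceed_count a {l..<u}) =
      (\<Sum>n\<in>{l..<u}. integral\<^sup>L (gauss_seq N) (\<lambda>x. if a \<le> running_mean x n then 1 else 0))"
    unfolding exceed_count_def[abs_def]
    by (rule Bochner_Integration.integral_sum) (auto intro!: integrable_const_bound[where B = 1])
  also have "\<dots> \<le> (\<Sum>n\<in>{l..<u}. ?q ^ n)"
  proof (rule sum_mono)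
    fix n assume n: "n \<in> {l..<u}"
    have "integral\<^sup>L (gauss_seq N) (\<lambda>x. if a \<le> running_mean x n then 1 else 0 :: real)
        = integral\<^sup>L (gauss_seq N) (indicator {x \<in> space (gauss_seq N). a \<le> running_mean x n})"
      by (rule Bochner_Integration.integral_cong) (auto simp: indicator_def)
    also have "\<dots> = prob {x \<in> space (gauss_seq N). a \<le> running_mean x n}"
      by simp
    also have "\<dots> \<le> prob {x \<in> space (gauss_seq N). \<exists>p\<in>{n..N}. a \<le> running_mean x p}"
      using n l by (intro finite_measure_mono) (auto intro!: bexI[of _ n])
    also have "\<dots> \<le> exp (- (real n * a\<^sup>2 / 2))"
      using n l a by (intro gauss_seq_mean_ge) auto
    also have "\<dots> = ?q ^ n"
      by (simp add: mult_ac flip: exp_of_nat_mult)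
    finally show "integral\<^sup>L (gauss_seq N) (\<lambda>x. if a \<le> running_mean x n then 1 else 0) \<le> ?q ^ n" .
  qed
  also have "\<dots> \<le> ?q ^ l / (1 - ?q)"
  proof (cases "l < u")
    case True
    then have "(\<Sum>n\<in>{l..<u}. ?q ^ n) = (?q ^ l - ?q ^ u) / (1 - ?q)"
      using q sum_gp[of ?q l "u - 1"]
      by (cases u) (auto simp: atLeastLessThanSuc_atLeastAtMost)
    also have "\<dots> \<le> ?q ^ l / (1 - ?q)"
      using q by (intro divide_right_mono) auto
    finally show ?thesis .
  qed (use q in auto)
  finally show ?thesis .
qed

context gauss_obs
begin

lemma integral_row:
  assumes "i < k" "f \<in> borel_measurable (gauss_seq N)"
  shows "expectation (\<lambda>X. f (zrow i X)) = integral\<^sup>L (gauss_seq N) (f :: _ \<Rightarrow> real)"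
  using integral_distr[OF measurable_std_row assms(2), of \<mu> \<sigma> k i] assms(1) by (simp add: distr_row)

lemma integrable_row_exceed_count: "integrable M (\<lambda>X. exceed_count a A (zrow i X))"
  by (rule integrable_const_bound[where B = "real (card A)"])
    (auto simp: exceed_count_nonneg exceed_count_le)

text \<open>Rows are independent and the count over times below \<open>u\<close> lies between 0 and
  \<open>u\<close>, so Hoeffding's inequality applies.\<close>

lemma prob_head_exceed:
  assumes a: "0 < a" and l: "1 \<le> l" "l < u" "u \<le> N" and \<gamma>: "0 < \<gamma>"
  defines "q \<equiv> exp (- (a\<^sup>2 / 2))"
  shows "prob {X \<in> space M. (q ^ l / (1 - q) + \<gamma>) * real k \<le> (\<Sum>i<k. exceed_count a {l..<u} (zrow i X))}
    \<le> exp (- (2 * \<gamma>\<^sup>2 / (real u)\<^sup>2 * real k))"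
proof -
  let ?X = "\<lambda>i X. exceed_count a {l..<u} (zrow i X)"
  interpret H: Hoeffding_ineq M "{..<k}" ?X "\<lambda>_. 0" "\<lambda>_. real u" "\<Sum>i<k. expectation (?X i)"
  proof unfold_locales
    show "indep_vars (\<lambda>_. borel) ?X {..<k}"
      by (rule indep_vars_compose2[OF indep_rows]) simp
    show "AE X in M. ?X i X \<in> {0..real u}" for i
    proof (rule AE_I2)
      fix X
      have "exceed_count a {l..<u} (zrow i X) \<le> real (u - l)"
        using exceed_count_le[of a "{l..<u}" "zrow i X"] by simp
      then show "?X i X \<in> {0..real u}"
        by (simp add: exceed_count_nonneg)
    qed
  qed auto
  have E: "(\<Sum>i<k. expectation (?X i)) \<le> q ^ l / (1 - q) * real k"
  proof -
    have "expectation (?X i) \<le> q ^ l / (1 - q)" if "i < k" for i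
      using integral_exceed_count_le[OF a l(1,3)] that by (subst integral_row) (auto simp: q_def)
    then have "(\<Sum>i<k. expectation (?X i)) \<le> (\<Sum>i<k. q ^ l / (1 - q))"
      by (intro sum_mono) auto
    then show ?thesis by (simp add: mult_ac)
  qed
  have "prob {X \<in> space M. (q ^ l / (1 - q) + \<gamma>) * real k \<le> (\<Sum>i<k. ?X i X)}
      \<le> prob {X \<in> space M. (\<Sum>i<k. expectation (?X i)) + \<gamma> * real k \<le> (\<Sum>i<k. ?X i X)}"
    using E by (intro finite_measure_mono) (auto simp: algebra_simps)
  also have "\<dots> \<le> exp (- 2 * (\<gamma> * real k)\<^sup>2 / (\<Sum>i<k. (real u - 0)\<^sup>2))"
    using \<gamma> k_pos l by (intro H.Hoeffding_ineq_ge) auto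
  also have "- 2 * (\<gamma> * real k)\<^sup>2 / (\<Sum>i<k. (real u - 0)\<^sup>2) = - (2 * \<gamma>\<^sup>2 / (real u)\<^sup>2 * real k)"
    using k_pos l by (simp add: power2_eq_square field_simps)
  finally show ?thesis .
qed

text \<open>The range of these counts grows with \<open>N\<close>, so Markov's inequality is used;
  the expectation is geometrically small in \<open>l\<close>.\<close>

lemma prob_tail_exceed:
  assumes a: "0 < a" and l: "1 \<le> l" and \<gamma>: "0 < \<gamma>"
  defines "q \<equiv> exp (- (a\<^sup>2 / 2))"
  shows "prob {X \<in> space M. \<gamma> * real k \<le> (\<Sum>i<k. exceed_count a {l..<N} (zrow i X))} \<le> q ^ l / (1 - q) / \<gamma>"
proof -
  let ?X = "\<lambda>i X. exceed_count a {l..<N} (zrow i X)"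
  have "prob {X \<in> space M. \<gamma> * real k \<le> (\<Sum>i<k. ?X i X)} \<le> expectation (\<lambda>X. \<Sum>i<k. ?X i X) / (\<gamma> * real k)"
    using \<gamma> k_pos
    by (intro integral_Markov_inequality_measure[where A = "space M"])
      (auto intro!: Bochner_Integration.integrable_sum integrable_row_exceed_count sum_nonneg exceed_count_nonneg)
  also have "expectation (\<lambda>X. \<Sum>i<k. ?X i X) = (\<Sum>i<k. expectation (?X i))"
    by (intro Bochner_Integration.integral_sum integrable_row_exceed_count)
  also have "(\<Sum>i<k. expectation (?X i)) / (\<gamma> * real k) \<le> (\<Sum>i<k. q ^ l / (1 - q)) / (\<gamma> * real k)"
  proof (intro divide_right_mono sum_mono)
    fix i assume "i \<in> {..<k}"
    then show "expectation (?X i) \<le> q ^ l / (1 - q)"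
      using integral_exceed_count_le[OF a l, of N N] by (subst integral_row) (auto simp: q_def)
  qed (use \<gamma> in auto)
  also have "\<dots> = q ^ l / (1 - q) / \<gamma>"
    using k_pos by simp
  finally show ?thesis .
qed

end

text \<open>Weak law uniform in \<open>N\<close>, \<open>\<mu>\<close> and \<open>\<sigma>\<close>:
  the counts are split at a fixed time \<open>u\<close>, with Hoeffding for the bounded head and
  Markov for the tail.\<close>

lemma exceed_count_weak_law:
  assumes a: "0 < a" and l: "1 \<le> l" and \<gamma>: "0 < \<gamma>" and \<epsilon>: "0 < \<epsilon>"
  defines "q \<equiv> exp (- (a\<^sup>2 / 2))"
  obtains K where "\<And>k N \<mu> \<sigma>. K \<le> k \<Longrightarrow> k \<le> N \<Longrightarrow> gauss_obs \<sigma> k N \<Longrightarrow>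
    measure (obs_space \<mu> \<sigma> k N) {X \<in> space (obs_space \<mu> \<sigma> k N).
      (q ^ l / (1 - q) + \<gamma>) * real k \<le> (\<Sum>i<k. exceed_count a {l..<N} (std_row \<mu> \<sigma> N i X))} \<le> \<epsilon>"
proof -
  have q: "0 < q" "q < 1"
    using a by (auto simp: q_def)
  \<comment> \<open>Solved so that the Markov bound of the tail, with slack
    \<open>\<gamma> / 2\<close>, is at most \<open>\<epsilon> / 2\<close>.\<close>
  obtain u0 where u0: "q ^ u0 < \<epsilon> / 2 * (\<gamma> / 2) * (1 - q)"
    using real_arch_pow_inv[of "\<epsilon> / 2 * (\<gamma> / 2) * (1 - q)" q] q \<epsilon> \<gamma> by auto
  define u where "u = max u0 (Suc l)"
  have "q ^ u \<le> q ^ u0"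
    using q by (intro power_decreasing) (auto simp: u_def)
  with u0 have "q ^ u \<le> \<epsilon> / 2 * (\<gamma> / 2) * (1 - q)" by simp
  then have tail: "q ^ u / (1 - q) / (\<gamma> / 2) \<le> \<epsilon> / 2"
    using q \<gamma> by (simp add: field_simps)
  have u: "l < u"
    by (simp add: u_def)
  define s where "s = 2 * (\<gamma> / 2)\<^sup>2 / (real u)\<^sup>2"
  have s: "0 < s"
    using \<gamma> u by (simp add: s_def)
  \<comment> \<open>The second entry brings the Hoeffding bound \<open>exp (- s k)\<close> below
    \<open>\<epsilon> / 2\<close>; the first, with \<open>k \<le> N\<close>, ensures
    \<open>u \<le> N\<close>.\<close>
  define K where "K = max u (nat \<lceil>2 / (\<epsilon> * s)\<rceil>)"
  show thesis
  proof (rule that[of K])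
    fix k N \<mu> \<sigma> assume kN: "K \<le> k" "k \<le> N" and "gauss_obs \<sigma> k N"
    then interpret gauss_obs \<mu> \<sigma> k N by simp
    have uN: "u \<le> N"
      using kN by (simp add: K_def)
    have head: "exp (- (s * real k)) \<le> \<epsilon> / 2"
    proof -
      have "2 / (\<epsilon> * s) \<le> real K"
        by (auto simp: K_def intro: order_trans[OF real_nat_ceiling_ge])
      also have "\<dots> \<le> real k"
        using kN by simp
      finally have "2 / \<epsilon> \<le> s * real k"
        using \<epsilon> s by (simp add: field_simps)
      also have "\<dots> \<le> exp (s * real k)"
        using exp_ge_add_one_self[of "s * real k"] by linarith
      finally show ?thesis
        using \<epsilon> by (simp add: exp_minus field_simps)
    qed
    let ?H = "\<lambda>X. \<Sum>i<k. exceed_count a {l..<u} (zrow i X)"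
    let ?T = "\<lambda>X. \<Sum>i<k. exceed_count a {u..<N} (zrow i X)"
    have split: "(\<Sum>i<k. exceed_count a {l..<N} (zrow i X)) = ?H X + ?T X" for X
      using u uN by (simp add: exceed_count_def sum.atLeastLessThan_concat flip: sum.distrib)
    have "prob {X \<in> space M. (q ^ l / (1 - q) + \<gamma>) * real k \<le> (\<Sum>i<k. exceed_count a {l..<N} (zrow i X))}
        \<le> prob ({X \<in> space M. (q ^ l / (1 - q) + \<gamma> / 2) * real k \<le> ?H X} \<union> {X \<in> space M. \<gamma> / 2 * real k \<le> ?T X})"
      unfolding split by (intro finite_measure_mono) (auto simp: algebra_simps)
    also have "\<dots> \<le> prob {X \<in> space M. (q ^ l / (1 - q) + \<gamma> / 2) * real k \<le> ?H X}
        + prob {X \<in> space M. \<gamma> / 2 * real k \<le> ?T X}"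
      by (intro measure_Un_le) auto
    also have "prob {X \<in> space M. (q ^ l / (1 - q) + \<gamma> / 2) * real k \<le> ?H X} \<le> exp (- (s * real k))"
      unfolding q_def s_def using \<gamma> by (intro prob_head_exceed a l u uN) auto
    also have "prob {X \<in> space M. \<gamma> / 2 * real k \<le> ?T X} \<le> q ^ u / (1 - q) / (\<gamma> / 2)"
      unfolding q_def using \<gamma> l u by (intro prob_tail_exceed a) auto
    finally show "prob {X \<in> space M. (q ^ l / (1 - q) + \<gamma>) * real k
        \<le> (\<Sum>i<k. exceed_count a {l..<N} (zrow i X))} \<le> \<epsilon>"
      using head tail by simp
  qed
qed

section \<open>Measurability of the greedy dynamics\<close>

text \<open>A sample mean at a random count is handled by cases over countably many counts, and the
  rank is a finite sum of indicators. Measurable counts are an assumption here so that the induction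
  over rounds can alternate between sets and counts.\<close>

lemma pred_efg_set_if_counts:
  assumes X: "\<And>p. (\<lambda>X. X p) \<in> borel_measurable M"
    and c: "\<And>i. (\<lambda>X. efg_counts m k n0 X t i) \<in> measurable M (count_space UNIV)"
  shows "Measurable.pred M (\<lambda>X. i \<in> efg_set m k n0 X t)"
proof -
  let ?f = "\<lambda>X. sample_mean X (efg_counts m k n0 X t)"
  have f: "(\<lambda>X. ?f X j) \<in> borel_measurable M" for j
    unfolding sample_mean_running_mean
    by (rule measurable_compose_countable[where f = "\<lambda>c X. running_mean (\<lambda>l. X (j, l)) c", OF _ c])
      (rule borel_measurable_running_mean, rule X)
  have "Measurable.pred M (\<lambda>X. ?f X j > ?f X i \<or> ?f X j = ?f X i \<and> j < i)" for j
    using borel_measurable_less[OF f f, of i j] borel_measurable_eq[OF f f, of j i]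
    by (intro pred_intros_logic) (simp_all add: pred_def)
  then have h: "(\<lambda>X. \<Sum>j<k. if ?f X j > ?f X i \<or> ?f X j = ?f X i \<and> j < i then 1 else 0 :: real)
      \<in> borel_measurable M" (is "?h \<in> _")
    by (intro borel_measurable_sum measurable_If borel_measurable_const) (simp_all only: pred_def)
  have less: "Measurable.pred M (\<lambda>X. ?h X < real m)"
    unfolding pred_def by (rule borel_measurable_less[OF h borel_measurable_const])
  have eq: "i \<in> efg_set m k n0 X t \<longleftrightarrow> i < k \<and> ?h X < real m" for X
    by (simp add: efg_set_def top_set_def sum.If_cases Int_def)
  show ?thesis
  proof (cases "i < k")
    case True
    then show ?thesis
      using less by (simp only: eq simp_thms)
  next
    case False
    then show ?thesis
      by (simp only: eq simp_thms) (rule measurable_const, simp)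
  qed
qed

lemma measurable_efg_counts:
  assumes X: "\<And>p. (\<lambda>X. X p) \<in> borel_measurable M"
  shows "(\<lambda>X. efg_counts m k n0 X t i) \<in> measurable M (count_space UNIV)"
proof (induction t arbitrary: i)
  case (Suc t)
  have "{X \<in> space M. i \<in> efg_set m k n0 X t} \<in> sets M"
    using pred_efg_set_if_counts[OF X Suc] by (simp only: pred_def)
  moreover have "(\<lambda>X. Suc (efg_counts m k n0 X t i)) \<in> measurable M (count_space UNIV)"
    by (rule measurable_compose[OF Suc]) simp
  ultimately show ?case
    unfolding efg_counts_Suc using Suc by (intro measurable_If)
qed (simp only: efg_counts.simps(1) measurable_const space_count_space UNIV_I)

lemmas pred_efg_set = pred_efg_set_if_counts[OF _ measurable_efg_counts]

lemma efg_set_subset_measurable: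
  assumes X: "\<And>p. (\<lambda>X. X p) \<in> borel_measurable M"
  shows "{X \<in> space M. efg_set m k n0 X t \<subseteq> {..<g}} \<in> sets M"
proof -
  have eq: "efg_set m k n0 X t \<subseteq> {..<g} \<longleftrightarrow> (\<forall>i\<in>{g..<k}. i \<notin> efg_set m k n0 X t)" for X
    by (force simp: efg_set_def dest: top_set_less)
  have "{X \<in> space M. \<forall>i\<in>{g..<k}. i \<notin> efg_set m k n0 X t} \<in> sets M"
    by (intro sets.sets_Collect_finite_All sets.sets_Collect_neg)
      (use pred_efg_set[OF X X] in \<open>simp_all only: pred_def finite_atLeastLessThan\<close>)
  then show ?thesis
    by (simp only: eq)
qed

section \<open>Probability of good selection\<close>

text \<open>Sorted means make the set downward closed, and a finite downward closed set of naturals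
  is determined by its size.\<close>

lemma good_set_initial_segment:
  assumes "\<And>i j. i \<le> j \<Longrightarrow> j < k \<Longrightarrow> \<mu> j \<le> \<mu> i"
  shows "good_set m \<delta> k \<mu> = {..<card (good_set m \<delta> k \<mu>)}"
proof -
  let ?G = "good_set m \<delta> k \<mu>"
  have fin: "finite ?G"
    by (rule finite_subset[of _ "{..<k}"]) (auto simp: good_set_def)
  have "i < card ?G" if "i \<in> ?G" for i
  proof -
    have "{..i} \<subseteq> ?G"
    proof
      fix j assume "j \<in> {..i}"
      with that assms[of j i] show "j \<in> ?G"
        by (simp add: good_set_def)
    qed
    from card_mono[OF fin this] show ?thesis by simp
  qed
  then show ?thesis
    by (intro card_subset_eq) auto
qed

text \<open>Union bound around \<open>efg_set_subset_good\<close>. Here \<open>a\<close> is the half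
  gap \<open>\<delta> / 2\<close> in units of the largest standard deviation, \<open>L\<close> the
  argmin window and \<open>s\<close> the allowance for exceedances.\<close>

lemma PGS_lower_bound:
  fixes \<mu> \<sigma> :: "nat \<Rightarrow> real" and B :: nat
  assumes m: "0 < m" "m \<le> k" and \<delta>: "0 < \<delta>" and \<sigma>bar: "0 < \<sigma>bar"
    and sorted: "\<And>i j. i \<le> j \<Longrightarrow> j < k \<Longrightarrow> \<mu> j \<le> \<mu> i"
    and var: "\<And>i. i < k \<Longrightarrow> 0 < \<sigma> i" "\<And>i. i < k \<Longrightarrow> \<sigma> i \<le> \<sigma>bar"
    and gbar: "card (good_set m \<delta> k \<mu>) \<le> gbar"
    and n0: "1 \<le> n0" "n0 \<le> L" "L \<le> n0 + B"
  defines "a \<equiv> \<delta> / (2 * \<sigma>bar)" and "N \<equiv> n0 + B"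
  assumes argmin: "measure (gauss_seq N) {x \<in> space (gauss_seq N).
       \<exists>n\<in>{n0..N}. \<forall>p\<in>{n0..L}. running_mean x n < running_mean x p} \<le> \<epsilon>1"
    and lln: "measure (obs_space \<mu> \<sigma> k N) {X \<in> space (obs_space \<mu> \<sigma> k N).
      s \<le> (\<Sum>i<k. exceed_count a {n0..<N} (std_row \<mu> \<sigma> N i X))} \<le> \<epsilon>2"
    and budget: "real n0 * real k + real m * (real gbar * real L + s) \<le> real B"
  shows "1 - (real m * exp (- (real n0 * a\<^sup>2 / 2)) + real gbar * \<epsilon>1 + \<epsilon>2) \<le> PGS m \<delta> k n0 B \<mu> \<sigma>"
proof -
  interpret gauss_obs \<mu> \<sigma> k N
    by unfold_locales (use var m n0 in \<open>auto simp: N_def\<close>)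
  define g where "g = card (good_set m \<delta> k \<mu>)"
  have good: "good_set m \<delta> k \<mu> = {..<g}"
    unfolding g_def by (rule good_set_initial_segment) (use sorted in auto)
  have "{..<m} \<subseteq> good_set m \<delta> k \<mu>"
  proof
    fix i assume "i \<in> {..<m}"
    then have "i < k" "\<mu> (m - 1) \<le> \<mu> i"
      using m by (auto intro: sorted)
    then show "i \<in> good_set m \<delta> k \<mu>"
      using \<delta> by (simp add: good_set_def)
  qed
  then have mg: "m \<le> g"
    unfolding good by (simp add: lessThan_subset_iff)
  have "{..<g} \<subseteq> {..<k}"
    unfolding good[symmetric] by (auto simp: good_set_def)
  then have gk: "g \<le> k"
    by (simp add: lessThan_subset_iff)
  have bad: "\<mu> i < \<mu> (m - 1) - \<delta>" if "g \<le> i" "i < k" for i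
  proof -
    have "i \<notin> good_set m \<delta> k \<mu>"
      using that by (simp add: good)
    with that show ?thesis
      by (simp add: good_set_def)
  qed
  have a: "0 < a"
    using \<delta> \<sigma>bar by (simp add: a_def)
  obtain T where T: "T \<le> B" "B \<le> n0 * k + m * T" "\<And>X. efg_output m k n0 B X = efg_set m k n0 X T"
    using efg_output_eq[OF m] by metis
  \<comment> \<open>Three causes of failure: a dip in a row (applied to the top \<open>m\<close>), a
    late argmin in a row (applied to \<open>G\<close>), and too many exceedances in total.\<close>
  define E1 where "E1 i = {X \<in> space M. \<exists>p\<in>{n0..N}. running_mean (zrow i X) p \<le> - a}" for i
  define E2 where "E2 i = {X \<in> space M. \<exists>n\<in>{n0..N}. \<forall>p\<in>{n0..L}. running_mean (zrow i X) n < running_mean (zrow i X) p}" for i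
  define E3 where "E3 = {X \<in> space M. s \<le> (\<Sum>i<k. exceed_count a {n0..<N} (zrow i X))}"
  define S where "S = {X \<in> space M. efg_set m k n0 X T \<subseteq> {..<g}}"
  have E_meas: "E1 i \<in> sets M" "E2 i \<in> sets M" "E3 \<in> sets M" for i
    unfolding E1_def E2_def E3_def by measurable
  have S_meas: "S \<in> sets M"
    unfolding S_def by (rule efg_set_subset_measurable) (rule measurable_obs_space_component)
  have cover: "space M - S \<subseteq> (\<Union>i<m. E1 i) \<union> (\<Union>i<g. E2 i) \<union> E3"
  proof (rule ccontr)
    assume "\<not> ?thesis"
    then obtain X where X: "X \<in> space M" "X \<notin> S" "\<And>i. i < m \<Longrightarrow> X \<notin> E1 i"
      "\<And>i. i < g \<Longrightarrow> X \<notin> E2 i" "X \<notin> E3"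
      by auto
    let ?r = "\<lambda>i. running_mean (\<lambda>j. X (i, j))" and ?z = "\<lambda>i. running_mean (zrow i X)"
    \<comment> \<open>Midway between the \<open>m\<close>-th mean and the level
      \<open>\<mu> (m - 1) - \<delta>\<close> below which all alternatives outside \<open>G\<close>
      lie.\<close>
    let ?b = "\<mu> (m - 1) - \<delta> / 2"
    have r: "?r i n = \<mu> i + \<sigma> i * ?z i n" if "i < k" "n0 \<le> n" "n \<le> N" for i n
      using that var n0 by (intro running_mean_std_row) auto
    have "efg_set m k n0 X T \<subseteq> {..<g}"
    proof (rule efg_set_subset_good[where L = L and b = ?b, OF m(1) mg gk])
      fix i n assume i: "i < m" and n: "n0 \<le> n" "n \<le> n0 + T"
      have "- a < ?z i n"
        using X(1) X(3)[OF i] n T(1) by (auto simp: E1_def N_def not_le)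
      then have "\<sigma> i * - a \<le> \<sigma> i * ?z i n"
        using var(1)[of i] i m by (intro mult_left_mono) auto
      moreover have "\<sigma> i * a \<le> \<sigma>bar * a"
        using a var(2)[of i] i m by (intro mult_right_mono) auto
      moreover have "\<sigma>bar * a = \<delta> / 2"
        using \<sigma>bar by (simp add: a_def)
      moreover have "\<mu> (m - 1) \<le> \<mu> i"
        using i m by (intro sorted) auto
      moreover have "?r i n = \<mu> i + \<sigma> i * ?z i n"
        using i m n T(1) by (intro r) (auto simp: N_def)
      ultimately show "?b \<le> ?r i n"
        by simp
    next
      fix i n assume i: "i < g" and n: "n0 \<le> n" "n \<le> n0 + T"
      have "n \<in> {n0..N}"
        using n T(1) by (simp add: N_def)
      moreover have "\<forall>n\<in>{n0..N}. \<exists>p\<in>{n0..L}. ?z i p \<le> ?z i n"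
        using X(1) X(4)[OF i] by (simp add: E2_def not_less)
      ultimately obtain p where p: "p \<in> {n0..L}" "?z i p \<le> ?z i n"
        by blast
      have "\<sigma> i * ?z i p \<le> \<sigma> i * ?z i n"
        using var(1)[of i] i gk p(2) by (intro mult_left_mono) auto
      moreover have "?r i p = \<mu> i + \<sigma> i * ?z i p" "?r i n = \<mu> i + \<sigma> i * ?z i n"
        by (rule r; use i gk p(1) n n0 T(1) in \<open>simp add: N_def\<close>)+
      ultimately show "\<exists>p\<in>{n0..L}. ?r i p \<le> ?r i n"
        by (intro bexI[OF _ p(1)]) simp
    next
      let ?C = "\<lambda>i. {n. n0 \<le> n \<and> n < n0 + T \<and> ?b \<le> ?r i n}"
      have C: "real (card (?C i)) \<le> exceed_count a {n0..<N} (zrow i X)" if i: "i \<in> {g..<k}" for i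
      proof -
        \<comment> \<open>To reach \<open>?b\<close> an alternative outside \<open>G\<close> must
          deviate by more than \<open>\<delta> / 2\<close>, which is at least \<open>a\<close> of
          its own standard deviations.\<close>
        have "a \<le> ?z i n" if n: "n0 \<le> n" "n < n0 + T" "?b \<le> ?r i n" for n
        proof (rule ccontr)
          assume "\<not> ?thesis"
          then have "\<sigma> i * ?z i n \<le> \<sigma> i * a"
            using var(1)[of i] i by (intro mult_left_mono) auto
          also have "\<dots> \<le> \<sigma>bar * a"
            using a var(2)[of i] i by (intro mult_right_mono) auto
          also have "\<dots> = \<delta> / 2"
            using \<sigma>bar by (simp add: a_def)
          finally have "?r i n \<le> \<mu> i + \<delta> / 2"
            using r[of i n] i n T(1) by (simp add: N_def)
          with bad[of i] i n(3) show False
            by simp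
        qed
        then have "?C i \<subseteq> {n \<in> {n0..<N}. a \<le> ?z i n}"
          using T(1) by (auto simp: N_def)
        then have "card (?C i) \<le> card {n \<in> {n0..<N}. a \<le> ?z i n}"
          by (intro card_mono) auto
        then show ?thesis
          by (simp add: exceed_count_card)
      qed
      have "real (\<Sum>i\<in>{g..<k}. card (?C i)) \<le> (\<Sum>i\<in>{g..<k}. exceed_count a {n0..<N} (zrow i X))"
        unfolding of_nat_sum by (rule sum_mono) (rule C)
      also have "\<dots> \<le> (\<Sum>i<k. exceed_count a {n0..<N} (zrow i X))"
        by (intro sum_mono2) (auto simp: exceed_count_nonneg)
      also have "\<dots> < s"
        using X(1,5) by (simp add: E3_def not_le)
      finally have "real (\<Sum>i\<in>{g..<k}. card (?C i)) < s" .
      moreover have "real (g * L) \<le> real gbar * real L"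
        using gbar by (simp add: g_def mult_right_mono)
      \<comment> \<open>After exploration the budget still pays for this many rounds of
        \<open>m\<close> observations each.\<close>
      moreover have "real gbar * real L + s \<le> real T"
      proof -
        have "real B \<le> real (n0 * k + m * T)"
          using T(2) by (simp only: of_nat_le_iff)
        with budget have "real m * (real gbar * real L + s) \<le> real m * real T"
          by simp
        then show ?thesis
          using m(1) by simp
      qed
      ultimately have "real (g * L + (\<Sum>i\<in>{g..<k}. card (?C i))) < real T"
        unfolding of_nat_add by linarith
      then show "g * L + (\<Sum>i\<in>{g..<k}. card (?C i)) < T"
        by (simp only: of_nat_less_iff)
    qed
    with X(1,2) show False
      by (simp add: S_def)
  qed
  have "prob (space M - S) \<le> prob ((\<Union>i<m. E1 i) \<union> (\<Union>i<g. E2 i) \<union> E3)"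
    using cover E_meas by (intro finite_measure_mono) auto
  also have "\<dots> \<le> prob ((\<Union>i<m. E1 i) \<union> (\<Union>i<g. E2 i)) + prob E3"
    using E_meas by (intro measure_Un_le) auto
  also have "prob ((\<Union>i<m. E1 i) \<union> (\<Union>i<g. E2 i)) \<le> prob (\<Union>i<m. E1 i) + prob (\<Union>i<g. E2 i)"
    using E_meas by (intro measure_Un_le) auto
  also have "prob (\<Union>i<m. E1 i) \<le> (\<Sum>i<m. prob (E1 i))"
    using E_meas by (intro finite_measure_subadditive_finite) auto
  also have "\<dots> \<le> (\<Sum>i<m. exp (- (real n0 * a\<^sup>2 / 2)))"
  proof (rule sum_mono)
    fix i assume "i \<in> {..<m}"
    then have "prob (E1 i) = measure (gauss_seq N) {x \<in> space (gauss_seq N). \<exists>p\<in>{n0..N}. running_mean x p \<le> - a}"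
      unfolding E1_def using m by (intro prob_row) auto
    also have "\<dots> \<le> exp (- (real n0 * a\<^sup>2 / 2))"
      using a n0 by (intro gauss_seq_mean_le) auto
    finally show "prob (E1 i) \<le> exp (- (real n0 * a\<^sup>2 / 2))" .
  qed
  also have "prob (\<Union>i<g. E2 i) \<le> (\<Sum>i<g. prob (E2 i))"
    using E_meas by (intro finite_measure_subadditive_finite) auto
  also have "\<dots> \<le> (\<Sum>i<g. \<epsilon>1)"
  proof (rule sum_mono)
    fix i assume "i \<in> {..<g}"
    then have "prob (E2 i) = measure (gauss_seq N) {x \<in> space (gauss_seq N).
        \<exists>n\<in>{n0..N}. \<forall>p\<in>{n0..L}. running_mean x n < running_mean x p}"
      unfolding E2_def using gk by (intro prob_row) auto
    with argmin show "prob (E2 i) \<le> \<epsilon>1"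
      by simp
  qed
  also have "\<dots> \<le> real gbar * \<epsilon>1"
  proof -
    \<comment> \<open>Nonnegativity allows \<open>g\<close> to be replaced by its bound
      \<open>gbar\<close>.\<close>
    have "0 \<le> \<epsilon>1"
      using argmin measure_nonneg order_trans by blast
    then show ?thesis
      using gbar by (simp add: g_def mult_right_mono)
  qed
  also have "prob E3 \<le> \<epsilon>2"
    using lln by (simp add: E3_def)
  finally have "1 - prob S \<le> real m * exp (- (real n0 * a\<^sup>2 / 2)) + real gbar * \<epsilon>1 + \<epsilon>2"
    using prob_compl[OF S_meas] by simp
  moreover have "PGS m \<delta> k n0 B \<mu> \<sigma> = prob S"
    by (simp add: PGS_def Let_def S_def good T(3) flip: N_def)
  ultimately show ?thesis
    by simp
qed

lemma liminf_PGS_ge: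
  fixes \<mu> \<sigma> :: "nat \<Rightarrow> nat \<Rightarrow> real"
  assumes m: "m > 1" and \<delta>: "\<delta> > 0" and \<sigma>bar: "\<sigma>bar > 0"
    and sorted: "\<forall>k i j. i \<le> j \<and> j < k \<longrightarrow> \<mu> k j \<le> \<mu> k i"
    and var: "\<forall>k i. i < k \<longrightarrow> \<sigma> k i > 0 \<and> (\<sigma> k i)\<^sup>2 \<le> \<sigma>bar\<^sup>2"
    and gbar: "\<forall>k. card (good_set m \<delta> k (\<mu> k)) \<le> gbar"
    and \<alpha>: "0 < \<alpha>" "\<alpha> < 1"
    and ng: "ng \<ge> \<alpha> / 2 + 4 * \<alpha> * \<sigma>bar\<^sup>2 / \<delta>\<^sup>2"
    and n0_def: "n0 = nat \<lceil>8 * \<sigma>bar\<^sup>2 / \<delta>\<^sup>2 * ln (2 * real m / \<alpha>)\<rceil>"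
  shows "liminf (\<lambda>k. ereal (PGS m \<delta> k n0 (nat \<lfloor>(real n0 + ng) * real k\<rfloor>) (\<mu> k) (\<sigma> k))) \<ge> ereal (1 - \<alpha>)"
proof -
  define a where "a = \<delta> / (2 * \<sigma>bar)"
  \<comment> \<open>With this \<open>x\<close> the constant
    \<open>8 \<sigma>bar\<^sup>2 / \<delta>\<^sup>2\<close> equals \<open>1 / x\<close>, and the
    choice of \<open>n0\<close>, rounded up, gives
    \<open>q ^ n0 \<le> \<alpha> / (2 m)\<close>.\<close>
  define x where "x = a\<^sup>2 / 2"
  define q where "q = exp (- x)"
  have a: "0 < a" and x: "0 < x" and q: "0 < q" "q < 1"
    using \<delta> \<sigma>bar by (auto simp: a_def x_def q_def)
  have x_eq: "8 * \<sigma>bar\<^sup>2 / \<delta>\<^sup>2 = 1 / x"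
    using \<delta> \<sigma>bar by (simp add: x_def a_def power_divide power_mult_distrib)
  have ln_pos: "0 < ln (2 * real m / \<alpha>)"
  proof -
    have "1 < 2 * real m / \<alpha>"
      using m \<alpha> by (simp add: field_simps)
    then show ?thesis by simp
  qed
  have n0_ge: "ln (2 * real m / \<alpha>) / x \<le> real n0"
    unfolding n0_def x_eq by (simp add: real_nat_ceiling_ge)
  have n0_1: "1 \<le> n0"
  proof -
    have "0 < ln (2 * real m / \<alpha>) / x"
      using ln_pos x by simp
    with n0_ge show ?thesis by linarith
  qed
  have qn0: "q ^ n0 \<le> \<alpha> / (2 * real m)"
  proof -
    have "ln (2 * real m / \<alpha>) \<le> real n0 * x"
      using n0_ge x by (simp add: pos_divide_le_eq)
    then have "exp (- (real n0 * x)) \<le> exp (- ln (2 * real m / \<alpha>))"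
      by simp
    also have "\<dots> = \<alpha> / (2 * real m)"
      using m \<alpha> by (simp add: exp_minus)
    finally show ?thesis
      by (simp add: q_def flip: exp_of_nat_mult)
  qed
  define e where "e = q ^ n0 / (1 - q)"
  \<comment> \<open>The strict \<open>1 / (1 - q) < 1 + 1 / x\<close>, equivalent to
    \<open>1 + x < exp x\<close>, makes \<open>\<gamma>\<close> positive even for the smallest
    admissible \<open>ng\<close>.\<close>
  have e: "e < ng / real m"
  proof -
    have "1 + x < exp x"
      using x exp_minus_greater[of "- x"] by simp
    then have "1 / (1 - q) < 1 + 1 / x"
      using x q by (simp add: q_def exp_minus field_simps)
    then have "\<alpha> / (2 * real m) * (1 / (1 - q)) < \<alpha> / (2 * real m) * (1 + 1 / x)"
      using \<alpha> m by (intro mult_strict_left_mono) auto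
    moreover have "e \<le> \<alpha> / (2 * real m) * (1 / (1 - q))"
      using divide_right_mono[OF qn0, of "1 - q"] q by (simp add: e_def)
    moreover have "\<alpha> / (2 * real m) * (1 + 1 / x) \<le> ng / real m"
    proof -
      have "\<alpha> / 2 * (1 + 1 / x) = \<alpha> / 2 + 4 * \<alpha> * \<sigma>bar\<^sup>2 / \<delta>\<^sup>2"
        unfolding x_eq[symmetric] by (simp add: field_simps)
      with ng have "\<alpha> / 2 * (1 + 1 / x) / real m \<le> ng / real m"
        by (intro divide_right_mono) auto
      then show ?thesis by simp
    qed
    ultimately show ?thesis by linarith
  qed
  \<comment> \<open>Half of the slack goes into the weak law; the other half pays for the bounded
    number \<open>gbar * L\<close> of good rounds.\<close>
  define \<gamma> where "\<gamma> = (ng / real m - e) / 2"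
  have \<gamma>: "0 < \<gamma>"
    using e by (simp add: \<gamma>_def)
  \<comment> \<open>Dips of the top \<open>m\<close> cost \<open>\<alpha> / 2\<close>; the other
    half is shared by at most \<open>gbar\<close> late argmins and one excess of
    exceedances.\<close>
  define \<epsilon> where "\<epsilon> = \<alpha> / (2 * (real gbar + 1))"
  have \<epsilon>: "0 < \<epsilon>" "real gbar * \<epsilon> + \<epsilon> = \<alpha> / 2"
  proof -
    show "0 < \<epsilon>"
      using \<alpha> by (simp add: \<epsilon>_def)
    have "real gbar * \<epsilon> + \<epsilon> = (real gbar + 1) * \<epsilon>"
      by (simp add: algebra_simps)
    also have "\<dots> = \<alpha> / 2"
    proof -
      have "c * (\<alpha> / (2 * c)) = \<alpha> / 2" if "c \<noteq> 0" for c :: real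
        using that by simp
      from this[of "real gbar + 1"] show ?thesis
        unfolding \<epsilon>_def by linarith
    qed
    finally show "real gbar * \<epsilon> + \<epsilon> = \<alpha> / 2" .
  qed
  have ng_pos: "0 < ng"
  proof -
    have "0 < \<alpha> / 2 + 4 * \<alpha> * \<sigma>bar\<^sup>2 / \<delta>\<^sup>2"
      using \<alpha> \<delta> \<sigma>bar by (intro add_pos_pos) auto
    with ng show ?thesis by linarith
  qed
  obtain L where L: "n0 \<le> L"
    "\<And>N. L \<le> N \<Longrightarrow> measure (gauss_seq N) {x \<in> space (gauss_seq N).
       \<exists>n\<in>{n0..N}. \<forall>p\<in>{n0..L}. running_mean x n < running_mean x p} \<le> \<epsilon>"
    using gauss_seq_argmin_tight[OF n0_1 \<epsilon>(1)] by blast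
  obtain K where K: "\<And>k N \<mu> \<sigma>. K \<le> k \<Longrightarrow> k \<le> N \<Longrightarrow> gauss_obs \<sigma> k N \<Longrightarrow>
    measure (obs_space \<mu> \<sigma> k N) {X \<in> space (obs_space \<mu> \<sigma> k N).
      (e + \<gamma>) * real k \<le> (\<Sum>i<k. exceed_count a {n0..<N} (std_row \<mu> \<sigma> N i X))} \<le> \<epsilon>"
    by (rule exceed_count_weak_law[OF a n0_1 \<gamma> \<epsilon>(1), folded x_def, folded q_def, folded e_def]) (rule that)
  \<comment> \<open>In the last entry, the \<open>+ 1\<close> covers the observation that the floor
    in \<open>B\<close> may lose.\<close>
  define K' where "K' = max (max K m) (max L (nat \<lceil>(real gbar * real L + 1) / \<gamma>\<rceil>))"
  have "1 - \<alpha> \<le> PGS m \<delta> k n0 (nat \<lfloor>(real n0 + ng) * real k\<rfloor>) (\<mu> k) (\<sigma> k)" if k: "K' \<le> k" for k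
  proof -
    define B where "B = nat \<lfloor>(real n0 + ng) * real k\<rfloor>"
    have kK: "K \<le> k" "m \<le> k" "L \<le> k" and kg: "(real gbar * real L + 1) / \<gamma> \<le> real k"
    proof -
      show "K \<le> k" "m \<le> k" "L \<le> k"
        using k by (auto simp: K'_def)
      have "(real gbar * real L + 1) / \<gamma> \<le> real (nat \<lceil>(real gbar * real L + 1) / \<gamma>\<rceil>)"
        by (rule real_nat_ceiling_ge)
      also have "\<dots> \<le> real k"
        using k by (simp add: K'_def del: of_nat_nat)
      finally show "(real gbar * real L + 1) / \<gamma> \<le> real k" .
    qed
    have B: "(real n0 + ng) * real k - 1 \<le> real B"
      unfolding B_def by linarith
    \<comment> \<open>The weak law requires at least \<open>k\<close> observations per row;
      \<open>n0 \<ge> 1\<close> makes up for the rounding of \<open>B\<close>.\<close>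
    have kN: "k \<le> n0 + B"
    proof -
      have "1 * real k \<le> (real n0 + ng) * real k"
        using n0_1 ng_pos by (intro mult_right_mono) auto
      with B n0_1 show ?thesis by linarith
    qed
    have sd: "\<sigma> k i \<le> \<sigma>bar" if "i < k" for i
      using var that \<sigma>bar power2_le_imp_le by (metis less_imp_le)
    have "1 - (real m * exp (- (real n0 * a\<^sup>2 / 2)) + real gbar * \<epsilon> + \<epsilon>)
        \<le> PGS m \<delta> k n0 B (\<mu> k) (\<sigma> k)"
      unfolding a_def
    proof (rule PGS_lower_bound[OF _ kK(2) \<delta> \<sigma>bar _ _ sd gbar[rule_format] n0_1 L(1)])
      show "L \<le> n0 + B"
        using kK kN by simp
      then show "measure (gauss_seq (n0 + B)) {x \<in> space (gauss_seq (n0 + B)).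
       \<exists>n\<in>{n0..n0 + B}. \<forall>p\<in>{n0..L}. running_mean x n < running_mean x p} \<le> \<epsilon>"
        by (rule L(2))
      show "measure (obs_space (\<mu> k) (\<sigma> k) k (n0 + B)) {X \<in> space (obs_space (\<mu> k) (\<sigma> k) k (n0 + B)).
      (e + \<gamma>) * real k \<le> (\<Sum>i<k. exceed_count (\<delta> / (2 * \<sigma>bar)) {n0..<n0 + B} (std_row (\<mu> k) (\<sigma> k) (n0 + B) i X))} \<le> \<epsilon>"
        unfolding a_def[symmetric]
        by (rule K[OF kK(1) kN]) (unfold_locales, use var kK m n0_1 in auto)
      have "real gbar * real L + 1 \<le> \<gamma> * real k"
        using kg \<gamma> by (simp add: field_simps)
      then have "real gbar * real L + (e + \<gamma>) * real k \<le> (e + 2 * \<gamma>) * real k - 1"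
        by (simp add: algebra_simps)
      also have "e + 2 * \<gamma> = ng / real m"
      proof -
        have "c + 2 * ((d - c) / 2) = d" for c d :: real
          by (simp add: field_simps)
        then show ?thesis
          unfolding \<gamma>_def .
      qed
      finally have "real m * (real gbar * real L + (e + \<gamma>) * real k) \<le> real m * (ng / real m * real k - 1)"
        by (intro mult_left_mono) auto
      also have "\<dots> = ng * real k - real m"
        using m by (simp add: field_simps)
      finally show "real n0 * real k + real m * (real gbar * real L + (e + \<gamma>) * real k) \<le> real B"
        using B m by (simp add: algebra_simps)
    qed (use m var sorted in auto)
    moreover have "real m * exp (- (real n0 * a\<^sup>2 / 2)) \<le> \<alpha> / 2"
    proof -
      have "exp (- (real n0 * a\<^sup>2 / 2)) = q ^ n0"
        by (simp add: q_def x_def flip: exp_of_nat_mult)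
      with qn0 have "real m * exp (- (real n0 * a\<^sup>2 / 2)) \<le> real m * (\<alpha> / (2 * real m))"
        by (intro mult_left_mono) auto
      then show ?thesis
        using m by simp
    qed
    ultimately show ?thesis
      using \<epsilon>(2) by (simp add: B_def)
  qed
  then show ?thesis
    by (intro Liminf_bounded eventually_sequentiallyI[of K']) simp
qed

text \<open>Exploration size and budget are rounded up and down to naturals. The consistency half
  also records \<open>real n0 < c\<close>, so that a positive share of the budget is left to the
  greedy phase.\<close>

theorem theorem2:
  fixes m gbar :: nat and \<delta> \<sigma>bar :: real and \<mu> \<sigma> :: "nat \<Rightarrow> nat \<Rightarrow> real"
  assumes m_gt: "m > 1" and delta_pos: "\<delta> > 0" and sbar_pos: "\<sigma>bar > 0"
    and sorted: "\<forall>k i j. i \<le> j \<and> j < k \<longrightarrow> \<mu> k j \<le> \<mu> k i"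
    and var_bound: "\<forall>k i. i < k \<longrightarrow> \<sigma> k i > 0 \<and> (\<sigma> k i)\<^sup>2 \<le> \<sigma>bar\<^sup>2"
    and good_bound: "\<forall>k. card (good_set m \<delta> k (\<mu> k)) \<le> gbar"
  shows "(\<forall>\<alpha> ng. 0 < \<alpha> \<and> \<alpha> < 1 \<and> ng \<ge> \<alpha> / 2 + 4 * \<alpha> * \<sigma>bar\<^sup>2 / \<delta>\<^sup>2 \<longrightarrow>
            (let n0 = nat \<lceil>8 * \<sigma>bar\<^sup>2 / \<delta>\<^sup>2 * ln (2 * real m / \<alpha>)\<rceil>
             in liminf (\<lambda>k. ereal (PGS m \<delta> k n0 (nat \<lfloor>(real n0 + ng) * real k\<rfloor>) (\<mu> k) (\<sigma> k)))
                  \<ge> ereal (1 - \<alpha>)))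
       \<and> (\<forall>\<alpha>. 0 < \<alpha> \<and> \<alpha> < 1 \<longrightarrow>
            (\<exists>c > 0. \<exists>n0::nat. real n0 < c \<and>
               liminf (\<lambda>k. ereal (PGS m \<delta> k n0 (nat \<lfloor>c * real k\<rfloor>) (\<mu> k) (\<sigma> k)))
                 \<ge> ereal (1 - \<alpha>)))"
proof (intro conjI allI impI)
  note liminf = liminf_PGS_ge[OF m_gt delta_pos sbar_pos sorted var_bound good_bound]
  fix \<alpha> ng :: real
  assume "0 < \<alpha> \<and> \<alpha> < 1 \<and> ng \<ge> \<alpha> / 2 + 4 * \<alpha> * \<sigma>bar\<^sup>2 / \<delta>\<^sup>2"
  then show "let n0 = nat \<lceil>8 * \<sigma>bar\<^sup>2 / \<delta>\<^sup>2 * ln (2 * real m / \<alpha>)\<rceil>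
      in liminf (\<lambda>k. ereal (PGS m \<delta> k n0 (nat \<lfloor>(real n0 + ng) * real k\<rfloor>) (\<mu> k) (\<sigma> k))) \<ge> ereal (1 - \<alpha>)"
    unfolding Let_def by (intro liminf) auto
next
  note liminf = liminf_PGS_ge[OF m_gt delta_pos sbar_pos sorted var_bound good_bound]
  fix \<alpha> :: real
  assume \<alpha>: "0 < \<alpha> \<and> \<alpha> < 1"
  define n0 where "n0 = nat \<lceil>8 * \<sigma>bar\<^sup>2 / \<delta>\<^sup>2 * ln (2 * real m / \<alpha>)\<rceil>"
  \<comment> \<open>The least admissible value; the constant of the consistency claim is then
    \<open>n0 + ng\<close>.\<close>
  define ng where "ng = \<alpha> / 2 + 4 * \<alpha> * \<sigma>bar\<^sup>2 / \<delta>\<^sup>2"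
  have "0 < ng"
    unfolding ng_def using \<alpha> delta_pos sbar_pos by (intro add_pos_pos) auto
  moreover have "liminf (\<lambda>k. ereal (PGS m \<delta> k n0 (nat \<lfloor>(real n0 + ng) * real k\<rfloor>) (\<mu> k) (\<sigma> k))) \<ge> ereal (1 - \<alpha>)"
    using \<alpha> by (intro liminf n0_def) (auto simp: ng_def)
  ultimately show "\<exists>c > 0. \<exists>n0::nat. real n0 < c \<and>
      liminf (\<lambda>k. ereal (PGS m \<delta> k n0 (nat \<lfloor>c * real k\<rfloor>) (\<mu> k) (\<sigma> k))) \<ge> ereal (1 - \<alpha>)"
    by (intro exI[of _ "real n0 + ng"] conjI exI[of _ n0]) auto
qed

end
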